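(* Let $\sigma_3\in\{1,-1\}$, $\delta\in\mathbb{R}$, $M>0$, and let $q,s\in\mathbb{R}$. The linear initial value problem $$\partial_t\Psi=A\Psi,\qquad \Psi(0)=\Psi_0,\qquad A=\begin{pmatrix}\sigma_3\partial_x+i\delta\partial_x^2&0&0\\0&0&-\partial_x^2\\0&-\frac1{M^2}&0\end{pmatrix},$$ is well-posed in $H^q(\mathbb{T})\times H^s(\mathbb{T})\times H^{s+1}(\mathbb{T})$. That is, for every $\Psi_0\in H^q(\mathbb{T})\times H^s(\mathbb{T})\times H^{s+1}(\mathbb{T})$ the problem has a unique solution $$\Psi\in C\big([0,\infty);H^q(\mathbb{T})\times H^s(\mathbb{T})\times H^{s+1}(\mathbb{T})\big)\cap C^1\big([0,\infty);H^{q-2}(\mathbb{T})\times H^{s-1}(\mathbb{T})\times H^{s}(\mathbb{T})\big),$$ which depends continuously on the initial data.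
   Context: $\mathbb{T}=\mathbb{R}/2\pi\mathbb{Z}$. For $r\in\mathbb{R}$, $H^r(\mathbb{T})$ is the Sobolev space of complex periodic distributions $f$ with $\|f\|_r=\big(2\pi\sum_{k\in\mathbb{Z}}(1+k^2)^r|\widehat f(k)|^2\big)^{1/2}<\infty$, where $\widehat f(k)=\frac1{2\pi}\langle f,e^{-ikx}\rangle$. Products of such spaces carry the sum of the component norms. Derivatives in $x$ are taken in the sense of periodic distributions; the time derivative is taken in the norm of $H^{q-2}(\mathbb{T})\times H^{s-1}(\mathbb{T})\times H^{s}(\mathbb{T})$ (one-sided at $t=0$), and the equation holds in that space for every $t\ge0$. *)

theory Defs
  imports "HOL-Analysis.Analysis"
begin

section \<open>Periodic test functions\<close>

definition fderiv :: "(real \<Rightarrow> complex) \<Rightarrow> real \<Rightarrow> complex" where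
  "fderiv \<phi> = (\<lambda>x. vector_derivative \<phi> (at x))"

text \<open>\<open>C\<^sup>\<infinity>(\<T>)\<close>, as the smooth functions on the line of period \<open>2\<pi>\<close>.\<close>

definition test_functions :: "(real \<Rightarrow> complex) set" where
  "test_functions =
     {\<phi>. (\<forall>x. \<phi> (x + 2 * pi) = \<phi> x) \<and> (\<forall>n x. (fderiv ^^ n) \<phi> differentiable at x)}"

text \<open>The seminorms defining the Frechet topology of \<open>C\<^sup>\<infinity>(\<T>)\<close>; by periodicity one period suffices.\<close>

definition test_seminorm :: "nat \<Rightarrow> (real \<Rightarrow> complex) \<Rightarrow> real" where
  "test_seminorm n \<phi> = (\<Sum>j\<le>n. SUP x\<in>{0..2 * pi}. cmod ((fderiv ^^ j) \<phi> x))"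

lemma fderiv_periodic:
  assumes "\<And>x. \<phi> (x + 2 * pi) = \<phi> x" and "\<And>x. \<phi> differentiable at x"
  shows "fderiv \<phi> (x + 2 * pi) = fderiv \<phi> x"
proof -
  have "(\<phi> has_vector_derivative fderiv \<phi> (x + 2 * pi)) (at (x + 2 * pi))"
    using assms(2) by (simp add: fderiv_def vector_derivative_works[symmetric])
  moreover have "((\<lambda>y. y + 2 * pi) has_vector_derivative 1) (at x)"
    by (auto intro!: derivative_eq_intros)
  ultimately have "((\<lambda>y. \<phi> (y + 2 * pi)) has_vector_derivative fderiv \<phi> (x + 2 * pi)) (at x)"
    using vector_diff_chain_at[of "\<lambda>y. y + 2 * pi" 1 x \<phi>] by (simp add: o_def)
  then show ?thesis
    using assms(1) by (simp add: fderiv_def vector_derivative_at)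
qed

lemma fderiv_test: "\<phi> \<in> test_functions \<Longrightarrow> fderiv \<phi> \<in> test_functions"
proof -
  assume a: "\<phi> \<in> test_functions"
  have d: "(fderiv ^^ n) \<phi> differentiable at x" for n x
    using a by (simp add: test_functions_def)
  have "(fderiv ^^ n) (fderiv \<phi>) differentiable at x" for n x
    using d[of "Suc n" x] by (simp add: funpow_swap1)
  moreover have "fderiv \<phi> (x + 2 * pi) = fderiv \<phi> x" for x
    using a d[of 0] by (intro fderiv_periodic) (auto simp: test_functions_def)
  ultimately show ?thesis
    by (simp add: test_functions_def)
qed

lemma fderiv_add:
  "(\<And>x. \<phi> differentiable at x) \<Longrightarrow> (\<And>x. \<psi> differentiable at x) \<Longrightarrow>
    fderiv (\<lambda>x. \<phi> x + \<psi> x) = (\<lambda>x. fderiv \<phi> x + fderiv \<psi> x)"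
  by (auto simp: fderiv_def)

lemma fderiv_scale:
  assumes "\<And>x. \<phi> differentiable at x"
  shows "fderiv (\<lambda>x. c * \<phi> x) = (\<lambda>x. c * fderiv \<phi> x)"
proof
  fix x
  have "(\<phi> has_vector_derivative fderiv \<phi> x) (at x)"
    using assms by (simp add: fderiv_def vector_derivative_works[symmetric])
  from has_vector_derivative_mult_right[OF this, of c]
  show "fderiv (\<lambda>x. c * \<phi> x) x = c * fderiv \<phi> x"
    unfolding fderiv_def by (rule vector_derivative_at)
qed

lemma test_add:
  assumes "\<phi> \<in> test_functions" "\<psi> \<in> test_functions"
  shows "(\<lambda>x. \<phi> x + \<psi> x) \<in> test_functions"
proof -
  have d: "(fderiv ^^ n) \<phi> differentiable at x" "(fderiv ^^ n) \<psi> differentiable at x" for n x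
    using assms by (simp_all add: test_functions_def)
  have "(fderiv ^^ n) (\<lambda>x. \<phi> x + \<psi> x) = (\<lambda>x. (fderiv ^^ n) \<phi> x + (fderiv ^^ n) \<psi> x)" for n
    by (induction n) (simp_all add: fderiv_add d)
  then show ?thesis
    using assms d by (simp add: test_functions_def)
qed

lemma test_scale:
  assumes "\<phi> \<in> test_functions"
  shows "(\<lambda>x. c * \<phi> x) \<in> test_functions"
proof -
  have d: "(fderiv ^^ n) \<phi> differentiable at x" for n x
    using assms by (simp add: test_functions_def)
  have "(fderiv ^^ n) (\<lambda>x. c * \<phi> x) = (\<lambda>x. c * (fderiv ^^ n) \<phi> x)" for n
    by (induction n) (simp_all add: fderiv_scale d)
  then show ?thesis
    using assms d by (simp add: test_functions_def)
qed

lemma test_seminorm_fderiv: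
  assumes "\<phi> \<in> test_functions"
  shows "test_seminorm n (fderiv \<phi>) \<le> test_seminorm (Suc n) \<phi>"
proof -
  let ?S = "\<lambda>j. SUP x\<in>{0..2 * pi}. cmod ((fderiv ^^ j) \<phi> x)"
  have "\<phi> differentiable at x" for x
    using assms by (auto simp: test_functions_def dest: spec[of _ 0])
  then have "continuous_on {0..2 * pi} \<phi>"
    by (meson continuous_at_imp_continuous_on differentiable_imp_continuous_within)
  then have "compact ((\<lambda>x. cmod (\<phi> x)) ` {0..2 * pi})"
    by (intro compact_continuous_image continuous_on_norm) auto
  then have "bdd_above ((\<lambda>x. cmod (\<phi> x)) ` {0..2 * pi})"
    by (simp add: bounded_imp_bdd_above compact_imp_bounded)
  then have "0 \<le> ?S 0"
    by (intro cSUP_upper2[where x = 0]) auto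
  moreover have "test_seminorm n (fderiv \<phi>) = (\<Sum>j\<le>n. ?S (Suc j))"
    by (simp add: test_seminorm_def funpow_swap1)
  moreover have "test_seminorm (Suc n) \<phi> = ?S 0 + (\<Sum>j\<le>n. ?S (Suc j))"
    unfolding test_seminorm_def by (rule sum.atMost_Suc_shift)
  ultimately show ?thesis by linarith
qed

lemma test_seminorm_nonneg:
  assumes "\<phi> \<in> test_functions"
  shows "0 \<le> test_seminorm n \<phi>"
  unfolding test_seminorm_def
proof (rule sum_nonneg)
  fix j
  have "(fderiv ^^ j) \<phi> differentiable at x" for x
    using assms by (simp add: test_functions_def)
  then have "continuous_on {0..2 * pi} ((fderiv ^^ j) \<phi>)"
    by (meson continuous_at_imp_continuous_on differentiable_imp_continuous_within)
  then have "compact ((\<lambda>x. cmod ((fderiv ^^ j) \<phi> x)) ` {0..2 * pi})"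
    by (intro compact_continuous_image continuous_on_norm) auto
  then have "bdd_above ((\<lambda>x. cmod ((fderiv ^^ j) \<phi> x)) ` {0..2 * pi})"
    by (simp add: bounded_imp_bdd_above compact_imp_bounded)
  then show "0 \<le> (SUP x\<in>{0..2 * pi}. cmod ((fderiv ^^ j) \<phi> x))"
    by (intro cSUP_upper2[where x = 0]) auto
qed

lemma test_seminorm_mono:
  assumes "\<phi> \<in> test_functions" "m \<le> n"
  shows "test_seminorm m \<phi> \<le> test_seminorm n \<phi>"
  using assms(2)
proof (induction n rule: dec_induct)
  case (step k)
  have "(fderiv ^^ Suc k) \<phi> \<in> test_functions"
    using assms(1) by (induction k) (simp_all add: fderiv_test)
  from test_seminorm_nonneg[OF this, of 0]
  have "test_seminorm k \<phi> \<le> test_seminorm (Suc k) \<phi>"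
    by (simp add: test_seminorm_def)
  with step show ?case by linarith
qed simp


lemma exp_test:
  "(\<lambda>x. exp (- \<i> * of_int k * of_real x)) \<in> test_functions"
proof -
  let ?e = "\<lambda>x::real. exp (- \<i> * of_int k * of_real x)"
  have d: "(?e has_vector_derivative (- \<i> * of_int k) * ?e x) (at x)" for x
    by (auto intro!: derivative_eq_intros has_vector_derivative_real_field)
  then have diff: "?e differentiable at x" for x
    using differentiableI_vector by blast
  have "fderiv ?e = (\<lambda>x. (- \<i> * of_int k) * ?e x)"
    unfolding fderiv_def using vector_derivative_at[OF d] by blast
  then have fe: "fderiv ?e x = (- \<i> * of_int k) * ?e x" for x
    by (rule fun_cong)
  have "(fderiv ^^ n) ?e = (\<lambda>x. (- \<i> * of_int k) ^ n * ?e x)" for n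
  proof (induction n)
    case (Suc n)
    have "(fderiv ^^ Suc n) ?e = fderiv (\<lambda>x. (- \<i> * of_int k) ^ n * ?e x)"
      using Suc by simp
    also have "\<dots> = (\<lambda>x. (- \<i> * of_int k) ^ n * fderiv ?e x)"
      by (rule fderiv_scale[OF diff])
    also have "\<dots> = (\<lambda>x. (- \<i> * of_int k) ^ Suc n * ?e x)"
      unfolding fe by (simp add: mult_ac)
    finally show ?case .
  qed simp
  moreover have "?e (x + 2 * pi) = ?e x" for x
  proof -
    have "?e (x + 2 * pi) = ?e x * exp (of_int (- k) * (2 * of_real pi * \<i>))"
      by (simp add: exp_add[symmetric] algebra_simps)
    also have "exp (of_int (- k) * (2 * of_real pi * \<i>)) = 1"
      using exp_integer_2pi[OF Ints_of_int, of "- k"] by (simp add: mult_ac)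
    finally show ?thesis by simp
  qed
  ultimately show ?thesis
    using diff by (simp add: test_functions_def)
qed


section \<open>Periodic distributions\<close>

text \<open>Continuous complex-linear functionals on \<open>C\<^sup>\<infinity>(\<T>)\<close>. They are total functions in HOL, so they
  are normalised to vanish off the test functions; this makes equality of distributions
  equality on test functions.\<close>

definition is_distribution :: "((real \<Rightarrow> complex) \<Rightarrow> complex) \<Rightarrow> bool" where
  "is_distribution u \<longleftrightarrow>
     (\<forall>\<phi>. \<phi> \<notin> test_functions \<longrightarrow> u \<phi> = 0) \<and>
     (\<forall>\<phi>\<in>test_functions. \<forall>\<psi>\<in>test_functions. u (\<lambda>x. \<phi> x + \<psi> x) = u \<phi> + u \<psi>) \<and>
     (\<forall>\<phi>\<in>test_functions. \<forall>c. u (\<lambda>x. c * \<phi> x) = c * u \<phi>) \<and>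
     (\<exists>n C. \<forall>\<phi>\<in>test_functions. cmod (u \<phi>) \<le> C * test_seminorm n \<phi>)"

lemma is_distribution_zero: "is_distribution (\<lambda>\<phi>. 0)"
  unfolding is_distribution_def by (auto intro!: exI[of _ "0::real"])

typedef pdistr = "{u. is_distribution u}" morphisms pairing Abs_pdistr
  using is_distribution_zero by blast

setup_lifting type_definition_pdistr

lemma is_distribution_add:
  assumes "is_distribution u" "is_distribution v"
  shows "is_distribution (\<lambda>\<phi>. u \<phi> + v \<phi>)"
proof -
  obtain m C n D where
    *: "\<And>\<phi>. \<phi> \<in> test_functions \<Longrightarrow> cmod (u \<phi>) \<le> C * test_seminorm m \<phi>"
       "\<And>\<phi>. \<phi> \<in> test_functions \<Longrightarrow> cmod (v \<phi>) \<le> D * test_seminorm n \<phi>"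
    using assms unfolding is_distribution_def by metis
  have "cmod (u \<phi> + v \<phi>) \<le> (\<bar>C\<bar> + \<bar>D\<bar>) * test_seminorm (max m n) \<phi>"
    if \<phi>: "\<phi> \<in> test_functions" for \<phi>
  proof -
    have "C * test_seminorm m \<phi> \<le> \<bar>C\<bar> * test_seminorm (max m n) \<phi>"
      by (rule mult_mono) (auto simp: \<phi> test_seminorm_mono test_seminorm_nonneg)
    moreover have "D * test_seminorm n \<phi> \<le> \<bar>D\<bar> * test_seminorm (max m n) \<phi>"
      by (rule mult_mono) (auto simp: \<phi> test_seminorm_mono test_seminorm_nonneg)
    ultimately show ?thesis
      using *[OF \<phi>] norm_triangle_ineq[of "u \<phi>" "v \<phi>"] by (simp add: distrib_right)
  qed
  then have "\<exists>n C. \<forall>\<phi>\<in>test_functions. cmod (u \<phi> + v \<phi>) \<le> C * test_seminorm n \<phi>"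
    by blast
  then show ?thesis
    using assms unfolding is_distribution_def by (simp add: algebra_simps)
qed

lemma is_distribution_scale:
  assumes "is_distribution u"
  shows "is_distribution (\<lambda>\<phi>. c * u \<phi>)"
proof -
  obtain n C where *: "\<And>\<phi>. \<phi> \<in> test_functions \<Longrightarrow> cmod (u \<phi>) \<le> C * test_seminorm n \<phi>"
    using assms unfolding is_distribution_def by metis
  have "cmod (c * u \<phi>) \<le> (cmod c * C) * test_seminorm n \<phi>" if "\<phi> \<in> test_functions" for \<phi>
    using mult_left_mono[OF *[OF that], of "cmod c"] by (simp add: norm_mult mult.assoc)
  then have "\<exists>n C. \<forall>\<phi>\<in>test_functions. cmod (c * u \<phi>) \<le> C * test_seminorm n \<phi>"
    by blast
  then show ?thesis
    using assms unfolding is_distribution_def by (simp add: algebra_simps)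
qed

lemma is_distribution_deriv:
  assumes "is_distribution u"
  shows "is_distribution (\<lambda>\<phi>. if \<phi> \<in> test_functions then - u (fderiv \<phi>) else 0)"
proof -
  have diff: "\<phi> differentiable at x" if "\<phi> \<in> test_functions" for \<phi> and x :: real
    using that by (auto simp: test_functions_def dest: spec[of _ 0])
  obtain n C where *: "\<And>\<phi>. \<phi> \<in> test_functions \<Longrightarrow> cmod (u \<phi>) \<le> C * test_seminorm n \<phi>"
    using assms unfolding is_distribution_def by metis
  have "cmod (u (fderiv \<phi>)) \<le> \<bar>C\<bar> * test_seminorm (Suc n) \<phi>" if \<phi>: "\<phi> \<in> test_functions" for \<phi>
  proof -
    have "C * test_seminorm n (fderiv \<phi>) \<le> \<bar>C\<bar> * test_seminorm (Suc n) \<phi>"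
      by (rule mult_mono) (auto simp: \<phi> test_seminorm_fderiv fderiv_test test_seminorm_nonneg)
    with *[OF fderiv_test[OF \<phi>]] show ?thesis by linarith
  qed
  then have "\<exists>n C. \<forall>\<phi>\<in>test_functions.
      cmod (if \<phi> \<in> test_functions then - u (fderiv \<phi>) else 0) \<le> C * test_seminorm n \<phi>"
    by auto
  then show ?thesis
    using assms unfolding is_distribution_def
    by (simp add: test_add test_scale fderiv_add fderiv_scale diff fderiv_test)
qed

instantiation pdistr :: real_vector
begin

lift_definition zero_pdistr :: pdistr is "\<lambda>\<phi>. 0"
  by (rule is_distribution_zero)

lift_definition plus_pdistr :: "pdistr \<Rightarrow> pdistr \<Rightarrow> pdistr" is "\<lambda>u v \<phi>. u \<phi> + v \<phi>"
  by (rule is_distribution_add)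

lift_definition uminus_pdistr :: "pdistr \<Rightarrow> pdistr" is "\<lambda>u \<phi>. - u \<phi>"
  using is_distribution_scale[of _ "-1"] by simp

lift_definition minus_pdistr :: "pdistr \<Rightarrow> pdistr \<Rightarrow> pdistr" is "\<lambda>u v \<phi>. u \<phi> - v \<phi>"
  using is_distribution_add[OF _ is_distribution_scale[of _ "-1"]] by simp

lift_definition scaleR_pdistr :: "real \<Rightarrow> pdistr \<Rightarrow> pdistr" is "\<lambda>c u \<phi>. of_real c * u \<phi>"
  by (rule is_distribution_scale)

instance
  by standard (transfer; auto simp: algebra_simps)+

end

lift_definition cscale :: "complex \<Rightarrow> pdistr \<Rightarrow> pdistr" is "\<lambda>c u \<phi>. c * u \<phi>"
  by (rule is_distribution_scale)

lift_definition ddx :: "pdistr \<Rightarrow> pdistr"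
  is "\<lambda>u \<phi>. if \<phi> \<in> test_functions then - u (fderiv \<phi>) else 0"
  by (rule is_distribution_deriv)


section \<open>Sobolev spaces\<close>

definition fourier_coeff :: "pdistr \<Rightarrow> int \<Rightarrow> complex" where
  "fourier_coeff f k = pairing f (\<lambda>x. exp (- \<i> * of_int k * of_real x)) / (2 * pi)"

definition sobolev :: "real \<Rightarrow> pdistr set" where
  "sobolev r =
     {f. (\<lambda>k::int. (1 + (real_of_int k)\<^sup>2) powr r * (cmod (fourier_coeff f k))\<^sup>2) summable_on UNIV}"

text \<open>Meaningful only on \<open>sobolev r\<close>: a divergent sum has the value \<open>0\<close>.\<close>

definition sobolev_norm :: "real \<Rightarrow> pdistr \<Rightarrow> real" where
  "sobolev_norm r f =
     sqrt (2 * pi * (\<Sum>\<^sub>\<infinity>k::int. (1 + (real_of_int k)\<^sup>2) powr r * (cmod (fourier_coeff f k))\<^sup>2))"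

definition sobolev3 :: "real \<Rightarrow> real \<Rightarrow> real \<Rightarrow> (pdistr \<times> pdistr \<times> pdistr) set" where
  "sobolev3 a b c = sobolev a \<times> sobolev b \<times> sobolev c"

fun sobolev3_norm :: "real \<Rightarrow> real \<Rightarrow> real \<Rightarrow> pdistr \<times> pdistr \<times> pdistr \<Rightarrow> real" where
  "sobolev3_norm a b c (u, v, w) = sobolev_norm a u + sobolev_norm b v + sobolev_norm c w"


section \<open>Curves in a normed space\<close>

text \<open>The norms here live on subspaces \<open>X\<close> of one ambient vector space and depend on real parameters,
  so a normed space is given by its carrier \<open>X\<close> and its norm \<open>N\<close>. Membership in \<open>X\<close> is always
  demanded separately, since \<open>N\<close> has junk values off \<open>X\<close>.\<close>

definition converges_in ::
    "'a::real_vector set \<Rightarrow> ('a \<Rightarrow> real) \<Rightarrow> (real \<Rightarrow> 'a) \<Rightarrow> 'a \<Rightarrow> real filter \<Rightarrow> bool" where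
  "converges_in X N f l F \<longleftrightarrow>
     l \<in> X \<and> (\<forall>\<^sub>F t in F. f t \<in> X) \<and> ((\<lambda>t. N (f t - l)) \<longlongrightarrow> 0) F"

definition C0_curve :: "'a::real_vector set \<Rightarrow> ('a \<Rightarrow> real) \<Rightarrow> (real \<Rightarrow> 'a) \<Rightarrow> bool" where
  "C0_curve X N f \<longleftrightarrow>
     (\<forall>t\<ge>0. f t \<in> X \<and> converges_in X N f (f t) (at t within {0..}))"

definition has_time_derivative ::
    "'a::real_vector set \<Rightarrow> ('a \<Rightarrow> real) \<Rightarrow> (real \<Rightarrow> 'a) \<Rightarrow> 'a \<Rightarrow> real \<Rightarrow> bool" where
  "has_time_derivative X N f d t \<longleftrightarrow>
     converges_in X N (\<lambda>\<tau>. (1 / (\<tau> - t)) *\<^sub>R (f \<tau> - f t)) d (at t within {0..})"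

definition C1_curve :: "'a::real_vector set \<Rightarrow> ('a \<Rightarrow> real) \<Rightarrow> (real \<Rightarrow> 'a) \<Rightarrow> bool" where
  "C1_curve X N f \<longleftrightarrow> C0_curve X N f \<and>
     (\<exists>f'. (\<forall>t\<ge>0. has_time_derivative X N f (f' t) t) \<and> C0_curve X N f')"


section \<open>The initial value problem\<close>

fun opA :: "real \<Rightarrow> real \<Rightarrow> real \<Rightarrow> pdistr \<times> pdistr \<times> pdistr \<Rightarrow> pdistr \<times> pdistr \<times> pdistr" where
  "opA \<sigma>\<^sub>3 \<delta> M (u, v, w) =
     (\<sigma>\<^sub>3 *\<^sub>R ddx u + cscale (\<i> * of_real \<delta>) (ddx (ddx u)),
      - ddx (ddx w),
      - ((1 / M\<^sup>2) *\<^sub>R v))"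

text \<open>Only the values of \<open>\<Psi>\<close> on \<open>[0, \<infinity>)\<close> matter.\<close>

definition is_solution ::
    "real \<Rightarrow> real \<Rightarrow> real \<Rightarrow> real \<Rightarrow> real \<Rightarrow> pdistr \<times> pdistr \<times> pdistr
      \<Rightarrow> (real \<Rightarrow> pdistr \<times> pdistr \<times> pdistr) \<Rightarrow> bool" where
  "is_solution \<sigma>\<^sub>3 \<delta> M q s \<Psi>\<^sub>0 \<Psi> \<longleftrightarrow>
     C0_curve (sobolev3 q s (s + 1)) (sobolev3_norm q s (s + 1)) \<Psi> \<and>
     C1_curve (sobolev3 (q - 2) (s - 1) s) (sobolev3_norm (q - 2) (s - 1) s) \<Psi> \<and>
     (\<forall>t\<ge>0. has_time_derivative (sobolev3 (q - 2) (s - 1) s) (sobolev3_norm (q - 2) (s - 1) s)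
               \<Psi> (opA \<sigma>\<^sub>3 \<delta> M (\<Psi> t)) t) \<and>
     \<Psi> 0 = \<Psi>\<^sub>0"

text \<open>Continuity at \<open>\<Psi>\<^sub>0\<close> of the data-to-solution map, into both spaces of curves, each with the
  topology of uniform convergence (for \<open>C\<^sup>1\<close>: of the curve and of its derivative) on the bounded
  time intervals \<open>[0, T]\<close>.\<close>

definition depends_continuously_at ::
    "real \<Rightarrow> real \<Rightarrow> real \<Rightarrow> real \<Rightarrow> real \<Rightarrow> pdistr \<times> pdistr \<times> pdistr \<Rightarrow> bool" where
  "depends_continuously_at \<sigma>\<^sub>3 \<delta> M q s \<Psi>\<^sub>0 \<longleftrightarrow>
     (let X = sobolev3 q s (s + 1); N = sobolev3_norm q s (s + 1);
          Y = sobolev3 (q - 2) (s - 1) s; N' = sobolev3_norm (q - 2) (s - 1) s in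
      \<forall>\<Psi>. is_solution \<sigma>\<^sub>3 \<delta> M q s \<Psi>\<^sub>0 \<Psi> \<longrightarrow>
        (\<forall>T>0. \<forall>\<epsilon>>0. \<exists>\<eta>>0. \<forall>\<Phi>\<^sub>0\<in>X. \<forall>\<Phi>.
           is_solution \<sigma>\<^sub>3 \<delta> M q s \<Phi>\<^sub>0 \<Phi> \<longrightarrow> N (\<Phi>\<^sub>0 - \<Psi>\<^sub>0) < \<eta> \<longrightarrow>
           (\<forall>t\<in>{0..T}.
              N (\<Phi> t - \<Psi> t) < \<epsilon> \<and> N' (\<Phi> t - \<Psi> t) < \<epsilon> \<and>
              (\<forall>a b. has_time_derivative Y N' \<Phi> a t \<longrightarrow> has_time_derivative Y N' \<Psi> b t
                 \<longrightarrow> N' (a - b) < \<epsilon>))))"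

end

theory Submission imports Defs begin

text \<open>In Fourier coefficients the problem decouples into scalar equations, solved by a phase for the
  first component and by the oscillator with frequency \<open>\<bar>k\<bar> / M\<close> for the other two (for \<open>k = 0\<close> a linear
  drift). With \<open>s\<close> derivatives on the second and \<open>s + 1\<close> on the third component, the propagator is
  bounded uniformly in \<open>k\<close> on bounded time intervals, and \<open>A\<close> is bounded from the first space into the
  second. Hence dominated convergence over the modes gives continuity and differentiability in time,
  uniqueness holds mode by mode, and linearity gives continuous dependence. It remains to know that a
  periodic distribution is determined by its Fourier coefficients, because the Fourier series of a
  test function converges in all seminorms, and that every sequence of polynomial growth occurs.\<close>

section \<open>Fourier series of test functions\<close>

text \<open>The orders \<open>s\<close> and \<open>s + 1\<close> come from the equations v' = k^2 w
  and w' = - v / M^2 of one mode: they conserve |v|^2 + M^2 k^2 |w|^2, which controls w with one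
  derivative more than v. This quantity degenerates at k = 0, where w drifts linearly; the bound on
  the propagator therefore contains T. Bounded norms alone would not give continuity in time, since
  high modes may oscillate arbitrarily fast. What is carried along instead is one square-summable
  majorant of the weighted coefficients for a whole time interval. Difference quotients get theirs
  from the mean value inequality, hence from a majorant of the derivative, and in general this is
  available only in the weaker space. The pointwise convergence of the Fourier series needs no
  summation kernel: division of \<phi> - \<phi>(x0) by e^(-ix) - e^(-i x0) reduces it to Bessel's
  inequality.\<close>

text \<open>The sign is that of \<open>fourier_coeff\<close>, which pairs a distribution with \<open>trig k\<close>. Accordingly
  \<open>test_coeff \<phi> k\<close> is the coefficient of \<open>trig k\<close> in \<open>\<phi>\<close>, that is, the usual one at \<open>- k\<close>.\<close>

definition trig :: "int \<Rightarrow> real \<Rightarrow> complex" where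
  "trig k = (\<lambda>x. exp (- \<i> * of_int k * of_real x))"

definition test_coeff :: "(real \<Rightarrow> complex) \<Rightarrow> int \<Rightarrow> complex" where
  "test_coeff \<phi> k = integral {0..2 * pi} (\<lambda>x. \<phi> x * trig (- k) x) / (2 * pi)"

lemma trig_0 [simp]: "trig 0 x = 1"
  by (simp add: trig_def)

lemma trig_mult: "trig j x * trig k x = trig (j + k) x"
  by (simp add: trig_def exp_add[symmetric] algebra_simps)

lemma trig_at_0 [simp]: "trig k 0 = 1"
  by (simp add: trig_def)

lemma trig_nonzero [simp]: "trig k x \<noteq> 0"
  by (simp add: trig_def)

lemma norm_trig [simp]: "cmod (trig k x) = 1"
  by (simp add: trig_def)

lemma cnj_trig: "cnj (trig k x) = trig (- k) x"
  by (simp add: trig_def exp_cnj)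

lemma trig_test: "trig k \<in> test_functions"
  unfolding trig_def by (rule exp_test)

lemma trig_periodic: "trig k (x + 2 * pi) = trig k x"
  using trig_test[of k] by (simp add: test_functions_def)

lemma trig_has_vector_derivative: "(trig k has_vector_derivative - \<i> * of_int k * trig k x) (at x within S)"
  unfolding trig_def by (auto intro!: derivative_eq_intros has_vector_derivative_real_field)

lemma continuous_on_trig [continuous_intros]: "continuous_on S (trig k)"
  unfolding trig_def by (intro continuous_intros)

lemma test_differentiable: "\<phi> \<in> test_functions \<Longrightarrow> \<phi> differentiable at x"
  by (auto simp: test_functions_def dest: spec[of _ 0])

lemma test_has_fderiv:
  "\<phi> \<in> test_functions \<Longrightarrow> (\<phi> has_vector_derivative fderiv \<phi> x) (at x)"
  using test_differentiable[of \<phi> x] by (simp add: fderiv_def vector_derivative_works[symmetric])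

lemma test_continuous_on: "\<phi> \<in> test_functions \<Longrightarrow> continuous_on S \<phi>"
  by (meson continuous_at_imp_continuous_on differentiable_imp_continuous_within test_differentiable)

lemma test_periodic: "\<phi> \<in> test_functions \<Longrightarrow> \<phi> (x + 2 * pi) = \<phi> x"
  by (simp add: test_functions_def)

lemma test_funpow_fderiv: "\<phi> \<in> test_functions \<Longrightarrow> (fderiv ^^ n) \<phi> \<in> test_functions"
  by (induction n) (auto intro: fderiv_test)

lemma test_zero: "(\<lambda>x. 0) \<in> test_functions"
  using test_scale[OF trig_test, of 0 0] by simp

lemma test_sum:
  "(\<And>i. i \<in> I \<Longrightarrow> f i \<in> test_functions) \<Longrightarrow> (\<lambda>x. \<Sum>i\<in>I. f i x) \<in> test_functions"
  by (induction I rule: infinite_finite_induct) (auto intro: test_zero test_add)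

lemma test_bound:
  assumes "\<phi> \<in> test_functions" "x \<in> {0..2 * pi}"
  shows "cmod ((fderiv ^^ j) \<phi> x) \<le> (SUP x\<in>{0..2 * pi}. cmod ((fderiv ^^ j) \<phi> x))"
proof -
  have "compact ((\<lambda>x. cmod ((fderiv ^^ j) \<phi> x)) ` {0..2 * pi})"
    using assms
    by (intro compact_continuous_image continuous_on_norm test_continuous_on test_funpow_fderiv) auto
  then have "bdd_above ((\<lambda>x. cmod ((fderiv ^^ j) \<phi> x)) ` {0..2 * pi})"
    by (simp add: bounded_imp_bdd_above compact_imp_bounded)
  with assms(2) show ?thesis by (rule cSUP_upper)
qed

lemma test_bound_seminorm:
  assumes "\<phi> \<in> test_functions" "x \<in> {0..2 * pi}" "j \<le> n"
  shows "cmod ((fderiv ^^ j) \<phi> x) \<le> test_seminorm n \<phi>"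
proof -
  have "0 \<le> (SUP x\<in>{0..2 * pi}. cmod ((fderiv ^^ i) \<phi> x))" for i
    by (rule order_trans[OF norm_ge_zero test_bound[OF assms(1), of 0]]) simp
  then have "(SUP x\<in>{0..2 * pi}. cmod ((fderiv ^^ j) \<phi> x)) \<le> test_seminorm n \<phi>"
    unfolding test_seminorm_def using assms(3) by (intro member_le_sum) auto
  with test_bound[OF assms(1,2)] show ?thesis by (rule order_trans)
qed

section \<open>Fourier coefficients of functions on the circle and their decay\<close>

lemma test_coeff_integrable:
  "continuous_on {0..2 * pi} g \<Longrightarrow> (\<lambda>x. g x * trig k x) integrable_on {0..2 * pi}"
  by (intro integrable_continuous_interval continuous_intros)

lemma test_coeff_add:
  assumes "continuous_on {0..2 * pi} f" "continuous_on {0..2 * pi} g"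
  shows "test_coeff (\<lambda>x. f x + g x) k = test_coeff f k + test_coeff g k"
  unfolding test_coeff_def using assms[THEN test_coeff_integrable]
  by (simp add: distrib_right Henstock_Kurzweil_Integration.integral_add add_divide_distrib)

lemma test_coeff_scale: "test_coeff (\<lambda>x. c * f x) k = c * test_coeff f k"
  unfolding test_coeff_def by (simp add: mult.assoc)

lemma test_coeff_sum:
  assumes "finite I" "\<And>i. i \<in> I \<Longrightarrow> continuous_on {0..2 * pi} (f i)"
  shows "test_coeff (\<lambda>x. \<Sum>i\<in>I. f i x) k = (\<Sum>i\<in>I. test_coeff (f i) k)"
  unfolding test_coeff_def using assms test_coeff_integrable
  by (simp add: sum_distrib_right Henstock_Kurzweil_Integration.integral_sum sum_divide_distrib)

lemma test_coeff_trig_shift: "test_coeff (\<lambda>x. trig j x * f x) k = test_coeff f (k - j)"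
proof -
  have "trig j x * f x * trig (- k) x = f x * trig (- (k - j)) x" for x
    using trig_mult[of j x "- k"] by (simp add: mult_ac)
  then show ?thesis unfolding test_coeff_def by (simp only:)
qed

lemma test_coeff_1: "test_coeff (\<lambda>x. 1) k = (if k = 0 then 1 else 0)"
proof (cases "k = 0")
  case False
  have "((\<lambda>x. - \<i> * of_int (- k) * trig (- k) x) has_integral trig (- k) (2 * pi) - trig (- k) 0) {0..2 * pi}"
    by (intro fundamental_theorem_of_calculus trig_has_vector_derivative) auto
  then have "((\<lambda>x. \<i> * of_int k * trig (- k) x) has_integral 0) {0..2 * pi}"
    using trig_periodic[of "- k" 0] by simp
  from has_integral_mult_right[OF this, of "1 / (\<i> * of_int k)"] False
  have "((\<lambda>x. trig (- k) x) has_integral 0) {0..2 * pi}" by simp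
  then show ?thesis using False by (simp add: test_coeff_def integral_unique)
qed (simp add: test_coeff_def scaleR_conv_of_real)

lemma test_coeff_trig: "test_coeff (trig j) k = (if k = j then 1 else 0)"
  using test_coeff_trig_shift[of j "\<lambda>x. 1" k] by (simp add: test_coeff_1)

lemma test_coeff_bound:
  assumes "continuous_on {0..2 * pi} g" "\<And>x. x \<in> {0..2 * pi} \<Longrightarrow> cmod (g x) \<le> B"
  shows "cmod (test_coeff g k) \<le> B"
proof -
  have "cmod (integral {0..2 * pi} (\<lambda>x. g x * trig (- k) x)) \<le> B * (2 * pi - 0)"
    using assms by (intro integral_bound continuous_intros) (auto simp: norm_mult)
  then show ?thesis unfolding test_coeff_def by (simp add: norm_divide field_simps)
qed

lemma test_coeff_fderiv:
  assumes "\<phi> \<in> test_functions"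
  shows "test_coeff (fderiv \<phi>) k = - \<i> * of_int k * test_coeff \<phi> k"
proof -
  let ?I = "integral {0..2 * pi} (\<lambda>x. \<phi> x * trig (- k) x)"
  have "((\<lambda>x. \<phi> x * trig (- k) x) has_integral ?I) {0..2 * pi}"
    using assms by (intro integrable_integral test_coeff_integrable test_continuous_on)
  from has_integral_mult_right[OF this, of "\<i> * of_int k"]
  have "((\<lambda>x. \<phi> x * (- \<i> * of_int (- k) * trig (- k) x)) has_integral \<i> * of_int k * ?I) {0..2 * pi}"
    by (simp add: mult_ac)
  \<comment> \<open>The boundary terms cancel by periodicity; they are written out because
    \<open>integration_by_parts\<close> expects the integral in this form.\<close>
  then have "((\<lambda>x. \<phi> x * (- \<i> * of_int (- k) * trig (- k) x)) has_integral
      \<phi> (2 * pi) * trig (- k) (2 * pi) - \<phi> 0 * trig (- k) 0 - - \<i> * of_int k * ?I) {0..2 * pi}"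
    using test_periodic[OF assms, of 0] trig_periodic[of "- k" 0] by simp
  then have "((\<lambda>x. fderiv \<phi> x * trig (- k) x) has_integral - \<i> * of_int k * ?I) {0..2 * pi}"
    using test_has_fderiv[OF assms] test_continuous_on[OF assms] continuous_on_trig
      trig_has_vector_derivative[of "- k", simplified]
    by (intro integration_by_parts[OF bounded_bilinear_mult, where f = \<phi> and
          g' = "\<lambda>x. - \<i> * of_int (- k) * trig (- k) x" and g = "trig (- k)"]) simp_all
  then show ?thesis unfolding test_coeff_def by (simp add: integral_unique)
qed

lemma test_coeff_funpow_fderiv:
  "\<phi> \<in> test_functions \<Longrightarrow> test_coeff ((fderiv ^^ n) \<phi>) k = (- \<i> * of_int k) ^ n * test_coeff \<phi> k"
  by (induction n) (simp_all add: test_coeff_fderiv test_funpow_fderiv mult_ac)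

text \<open>Each integration by parts gains a factor |k|. For k \<noteq> 0, 1 + k^2 is at most 2
  k^2, whence 2^m; the mode 0 uses the bound without derivatives.\<close>

lemma test_coeff_decay:
  assumes "\<phi> \<in> test_functions"
  shows "(1 + (real_of_int k)\<^sup>2) ^ m * cmod (test_coeff \<phi> k) \<le> 2 ^ m * test_seminorm (2 * m) \<phi>"
proof -
  have *: "\<bar>real_of_int k\<bar> ^ j * cmod (test_coeff \<phi> k) \<le> test_seminorm (2 * m) \<phi>" if "j \<le> 2 * m" for j
  proof -
    have "cmod (test_coeff ((fderiv ^^ j) \<phi>) k) \<le> test_seminorm (2 * m) \<phi>"
      using assms that by (intro test_coeff_bound test_continuous_on test_funpow_fderiv test_bound_seminorm)
    then show ?thesis by (simp add: test_coeff_funpow_fderiv assms norm_mult norm_power)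
  qed
  show ?thesis
  proof (cases "k = 0")
    case True
    then have "cmod (test_coeff \<phi> k) \<le> test_seminorm (2 * m) \<phi>" using *[of 0] by simp
    also have "\<dots> \<le> 2 ^ m * test_seminorm (2 * m) \<phi>"
      using test_seminorm_nonneg[OF assms, of "2 * m"] mult_right_mono[of 1 "2 ^ m" "test_seminorm (2 * m) \<phi>"]
      by simp
    finally show ?thesis using True by simp
  next
    case False
    then have "1 \<le> (real_of_int k)\<^sup>2"
      using one_le_power[of "\<bar>real_of_int k\<bar>" 2] by simp
    then have "(1 + (real_of_int k)\<^sup>2) ^ m \<le> (2 * (real_of_int k)\<^sup>2) ^ m"
      by (intro power_mono) auto
    also have "\<dots> = 2 ^ m * \<bar>real_of_int k\<bar> ^ (2 * m)"
      by (simp add: power_mult_distrib power_mult)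
    finally have "(1 + (real_of_int k)\<^sup>2) ^ m * cmod (test_coeff \<phi> k)
        \<le> 2 ^ m * (\<bar>real_of_int k\<bar> ^ (2 * m) * cmod (test_coeff \<phi> k))"
      by (simp add: mult_right_mono mult.assoc[symmetric])
    also have "\<dots> \<le> 2 ^ m * test_seminorm (2 * m) \<phi>"
      using *[of "2 * m"] by simp
    finally show ?thesis .
  qed
qed

lemma summable_on_inverse_1_plus_square:
  "(\<lambda>k::int. inverse (1 + (real_of_int k)\<^sup>2)) summable_on UNIV"
proof -
  have "summable (\<lambda>n::nat. inverse (1 + (real n)\<^sup>2))"
  proof (rule summable_comparison_test_ev)
    show "\<forall>\<^sub>F n in sequentially. norm (inverse (1 + (real n)\<^sup>2)) \<le> inverse ((real n)\<^sup>2)"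
      using eventually_gt_at_top[of 0] by eventually_elim (auto intro!: le_imp_inverse_le)
  qed (rule inverse_power_summable, simp)
  then have s: "(\<lambda>n::nat. inverse (1 + (real n)\<^sup>2)) summable_on UNIV"
    by (intro norm_summable_imp_summable_on) simp
  \<comment> \<open>The two ranges share 0, which is harmless for summability.\<close>
  have "(\<lambda>k::int. inverse (1 + (real_of_int k)\<^sup>2)) summable_on (range int \<union> range (\<lambda>n. - int n))"
    using s by (intro summable_on_union) (simp_all add: summable_on_reindex inj_on_def o_def)
  moreover have "range int \<union> range (\<lambda>n. - int n) = UNIV"
    by (metis (no_types, lifting) UNIV_eq_I UnCI int_cases2 rangeI)
  ultimately show ?thesis by simp
qed

text \<open>One power of the weight more than asked for is spent on the summable factor 1 / (1 +
  k^2).\<close>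

lemma test_coeff_summable_weight:
  assumes "\<phi> \<in> test_functions"
  shows "(\<lambda>k. (1 + (real_of_int k)\<^sup>2) ^ m * cmod (test_coeff \<phi> k)) summable_on UNIV"
proof (rule summable_on_comparison_test)
  let ?C = "2 ^ Suc m * test_seminorm (2 * Suc m) \<phi>"
  show "(\<lambda>k::int. ?C * inverse (1 + (real_of_int k)\<^sup>2)) summable_on UNIV"
    by (intro summable_on_cmult_right summable_on_inverse_1_plus_square)
  show "(1 + (real_of_int k)\<^sup>2) ^ m * cmod (test_coeff \<phi> k) \<le> ?C * inverse (1 + (real_of_int k)\<^sup>2)" for k
  proof -
    have p: "0 < 1 + (real_of_int k)\<^sup>2" by (simp add: add_pos_nonneg)
    show ?thesis
      using test_coeff_decay[OF assms, of k "Suc m"] p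
      by (simp add: divide_inverse[symmetric] pos_le_divide_eq mult_ac)
  qed
qed auto

section \<open>Bessel's inequality and the Riemann-Lebesgue lemma\<close>

text \<open>The mean of |g - P|^2 is nonnegative, where \<open>P\<close> is the Fourier sum over
  \<open>F\<close>; expanded, it is the mean of |g|^2 minus the sum of squares.\<close>

lemma Bessel:
  assumes g: "continuous_on {0..2 * pi} g" and F: "finite F"
  shows "(\<Sum>k\<in>F. (cmod (test_coeff g k))\<^sup>2) \<le> integral {0..2 * pi} (\<lambda>x. (cmod (g x))\<^sup>2) / (2 * pi)"
proof -
  define P where "P = (\<lambda>x. \<Sum>k\<in>F. test_coeff g k * trig k x)"
  \<comment> \<open>\<open>A\<close> is the mean over a period, so that
    \<open>A (\<lambda>x. h x * cnj (P x))\<close> is an inner product of \<open>h\<close> and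
    \<open>P\<close>.\<close>
  define A where "A h = integral {0..2 * pi} h / (2 * pi)" for h :: "real \<Rightarrow> complex"
  have P: "continuous_on {0..2 * pi} P" unfolding P_def by (intro continuous_intros)
  define S where "S = complex_of_real (\<Sum>k\<in>F. (cmod (test_coeff g k))\<^sup>2)"
  have S: "S = (\<Sum>k\<in>F. cnj (test_coeff g k) * test_coeff g k)"
    unfolding S_def by (simp add: complex_norm_square mult.commute del: of_real_power)
  have cP: "cnj (P x) = (\<Sum>k\<in>F. cnj (test_coeff g k) * trig (- k) x)" for x
    by (simp add: P_def cnj_trig)
  have int: "h integrable_on {0..2 * pi}" if "continuous_on {0..2 * pi} h" for h :: "real \<Rightarrow> complex"
    using that by (rule integrable_continuous_interval)
  have *: "A (\<lambda>x. h x * cnj (P x)) = (\<Sum>k\<in>F. cnj (test_coeff g k) * test_coeff h k)"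
    if "continuous_on {0..2 * pi} h" for h
  proof -
    have "integral {0..2 * pi} (\<lambda>x. h x * cnj (P x))
        = integral {0..2 * pi} (\<lambda>x. \<Sum>k\<in>F. cnj (test_coeff g k) * (h x * trig (- k) x))"
      by (simp add: cP sum_distrib_left mult_ac)
    also have "\<dots> = (\<Sum>k\<in>F. integral {0..2 * pi} (\<lambda>x. cnj (test_coeff g k) * (h x * trig (- k) x)))"
      using F that by (intro Henstock_Kurzweil_Integration.integral_sum int continuous_intros)
    finally show ?thesis by (simp add: A_def test_coeff_def sum_divide_distrib)
  qed
  have test_coeff_P: "test_coeff P k = test_coeff g k" if "k \<in> F" for k
  proof -
    have "test_coeff P k = (\<Sum>j\<in>F. test_coeff (\<lambda>x. test_coeff g j * trig j x) k)"
      unfolding P_def using F by (intro test_coeff_sum continuous_intros)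
    also have "\<dots> = (\<Sum>j\<in>F. if j = k then test_coeff g j else 0)"
      by (intro sum.cong) (auto simp: test_coeff_scale test_coeff_trig)
    finally show ?thesis using F that by simp
  qed
  have gP: "A (\<lambda>x. g x * cnj (P x)) = S" using *[OF g] S by simp
  have PP: "A (\<lambda>x. P x * cnj (P x)) = S" using *[OF P] S by (simp add: test_coeff_P)
  \<comment> \<open>This product is the conjugate of the one with \<open>g\<close> and
    \<open>P\<close> exchanged, and \<open>S\<close> is real.\<close>
  have Pg: "A (\<lambda>x. P x * cnj (g x)) = S"
  proof -
    have "cnj (A (\<lambda>x. g x * cnj (P x))) = A (\<lambda>x. P x * cnj (g x))"
      unfolding A_def by (simp add: integral_cnj mult.commute)
    then show ?thesis using gP by (simp add: S_def)
  qed
  have "A (\<lambda>x. (g x - P x) * cnj (g x - P x))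
      = A (\<lambda>x. (g x * cnj (g x) - g x * cnj (P x)) - (P x * cnj (g x) - P x * cnj (P x)))"
    by (simp add: algebra_simps)
  also have "\<dots> = A (\<lambda>x. g x * cnj (g x)) - S - (S - S)"
  proof -
    have c: "continuous_on {0..2 * pi} (\<lambda>x. g x * cnj (g x))" "continuous_on {0..2 * pi} (\<lambda>x. g x * cnj (P x))"
      "continuous_on {0..2 * pi} (\<lambda>x. P x * cnj (g x))" "continuous_on {0..2 * pi} (\<lambda>x. P x * cnj (P x))"
      using g P by (auto intro!: continuous_intros)
    have "A (\<lambda>x. f x - h x) = A f - A h"
      if "continuous_on {0..2 * pi} f" "continuous_on {0..2 * pi} h" for f h
      unfolding A_def using that[THEN int]
      by (simp add: Henstock_Kurzweil_Integration.integral_diff diff_divide_distrib)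
    with c gP Pg PP show ?thesis by (simp add: continuous_on_diff)
  qed
  finally have eq: "A (\<lambda>x. (g x - P x) * cnj (g x - P x)) = A (\<lambda>x. g x * cnj (g x)) - S" by simp
  have sq: "A (\<lambda>x. h x * cnj (h x)) = of_real (integral {0..2 * pi} (\<lambda>x. (cmod (h x))\<^sup>2) / (2 * pi))"
    if "continuous_on {0..2 * pi} h" for h
  proof -
    have "((\<lambda>x. (cmod (h x))\<^sup>2) has_integral integral {0..2 * pi} (\<lambda>x. (cmod (h x))\<^sup>2)) {0..2 * pi}"
      using that by (intro integrable_integral integrable_continuous_interval continuous_intros)
    then have "((\<lambda>x. complex_of_real ((cmod (h x))\<^sup>2)) has_integral
        of_real (integral {0..2 * pi} (\<lambda>x. (cmod (h x))\<^sup>2))) {0..2 * pi}"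
      by (rule has_integral_of_real)
    then have "((\<lambda>x. h x * cnj (h x)) has_integral
        of_real (integral {0..2 * pi} (\<lambda>x. (cmod (h x))\<^sup>2))) {0..2 * pi}"
      by (simp only: complex_norm_square)
    then show ?thesis by (simp add: A_def integral_unique)
  qed
  have "complex_of_real (integral {0..2 * pi} (\<lambda>x. (cmod (g x - P x))\<^sup>2) / (2 * pi))
      = of_real (integral {0..2 * pi} (\<lambda>x. (cmod (g x))\<^sup>2) / (2 * pi) - (\<Sum>k\<in>F. (cmod (test_coeff g k))\<^sup>2))"
    unfolding of_real_diff S_def[symmetric] sq[OF g, symmetric] eq[symmetric]
    using g P by (intro sq[symmetric] continuous_intros)
  then have "integral {0..2 * pi} (\<lambda>x. (cmod (g x - P x))\<^sup>2) / (2 * pi)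
      = integral {0..2 * pi} (\<lambda>x. (cmod (g x))\<^sup>2) / (2 * pi) - (\<Sum>k\<in>F. (cmod (test_coeff g k))\<^sup>2)"
    using of_real_eq_iff by blast
  moreover have "0 \<le> integral {0..2 * pi} (\<lambda>x. (cmod (g x - P x))\<^sup>2) / (2 * pi)"
    using g P by (intro divide_nonneg_pos Henstock_Kurzweil_Integration.integral_nonneg
        integrable_continuous_interval continuous_intros) auto
  ultimately show ?thesis by linarith
qed

text \<open>By Bessel the squared coefficients are summable, so they tend to 0 along every sequence
  of distinct modes; injective sequences reach both ends of the integers.\<close>

lemma Riemann_Lebesgue:
  assumes g: "continuous_on {0..2 * pi} g" and h: "inj (h :: nat \<Rightarrow> int)"
  shows "(\<lambda>n. test_coeff g (h n)) \<longlonglongrightarrow> 0"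
proof -
  have "(\<lambda>k. (cmod (test_coeff g k))\<^sup>2) summable_on UNIV"
    using Bessel[OF g] by (intro nonneg_bdd_above_summable_on) (auto intro!: bdd_aboveI2)
  then have "(\<lambda>k. (cmod (test_coeff g k))\<^sup>2) summable_on range h"
    by (rule summable_on_subset) auto
  then have "(\<lambda>n. (cmod (test_coeff g (h n)))\<^sup>2) summable_on UNIV"
    using h by (simp add: summable_on_reindex o_def)
  then have "(\<lambda>n. (cmod (test_coeff g (h n)))\<^sup>2) \<longlonglongrightarrow> 0"
    by (intro summable_LIMSEQ_zero summable_on_imp_summable)
  then have "(\<lambda>n. sqrt ((cmod (test_coeff g (h n)))\<^sup>2)) \<longlonglongrightarrow> sqrt 0"
    by (rule tendsto_real_sqrt)
  then show ?thesis by (simp add: tendsto_norm_zero_iff)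
qed

section \<open>Convergence of the Fourier series of a test function\<close>

text \<open>Serves the factorisation of test functions, and later links the quotients in
  \<open>has_time_derivative\<close> to ordinary derivatives of coefficients. One side divides by |y
  - x|, the other by y - x, which makes no difference inside a norm.\<close>

lemma has_vector_derivative_iff_quotient:
  fixes f :: "real \<Rightarrow> 'a::real_normed_vector"
  shows "(f has_vector_derivative D) (at x within S) \<longleftrightarrow>
    ((\<lambda>y. (1 / (y - x)) *\<^sub>R (f y - f x)) \<longlongrightarrow> D) (at x within S)"
proof -
  have "((\<lambda>y. (1 / norm (y - x)) *\<^sub>R (f y - (f x + (y - x) *\<^sub>R D))) \<longlongrightarrow> 0) (at x within S) \<longleftrightarrow>
      ((\<lambda>y. (1 / (y - x)) *\<^sub>R (f y - f x) - D) \<longlongrightarrow> 0) (at x within S)"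
  proof (subst (1 2) tendsto_norm_zero_iff[symmetric], rule tendsto_cong)
    have "norm ((1 / norm (y - x)) *\<^sub>R (f y - (f x + (y - x) *\<^sub>R D))) =
        norm ((1 / (y - x)) *\<^sub>R (f y - f x) - D)" if "y \<noteq> x" for y
    proof -
      have "(1 / (y - x)) *\<^sub>R (f y - f x) - D = (1 / (y - x)) *\<^sub>R (f y - (f x + (y - x) *\<^sub>R D))"
        using that by (simp add: scaleR_diff_right scaleR_add_right)
      then show ?thesis by simp
    qed
    then show "\<forall>\<^sub>F y in at x within S. norm ((1 / norm (y - x)) *\<^sub>R (f y - (f x + (y - x) *\<^sub>R D))) =
        norm ((1 / (y - x)) *\<^sub>R (f y - f x) - D)"
      by (auto simp: eventually_at intro: exI[of _ 1])
  qed
  then show ?thesis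
    by (simp add: has_vector_derivative_def has_derivative_within bounded_linear_scaleR_left LIM_zero_iff)
qed

text \<open>Symmetric intervals eventually contain every finite set, so they may be used to compute
  an unordered sum.\<close>

lemma has_sum_imp_int_interval_tendsto:
  fixes f :: "int \<Rightarrow> 'a::{comm_monoid_add, t2_space}"
  assumes "(f has_sum s) UNIV"
  shows "(\<lambda>N. sum f {- int N..int N}) \<longlonglongrightarrow> s"
proof -
  have "filterlim (\<lambda>N. {- int N..int N}) (finite_subsets_at_top UNIV) sequentially"
  proof (subst filterlim_finite_subsets_at_top, intro allI impI)
    fix X :: "int set" assume X: "finite X \<and> X \<subseteq> UNIV"
    have "X \<subseteq> {- int N..int N}" if N: "nat (\<Sum>x\<in>X. \<bar>x\<bar>) \<le> N" for N
    proof
      fix x assume "x \<in> X"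
      then have "\<bar>x\<bar> \<le> (\<Sum>x\<in>X. \<bar>x\<bar>)" using X by (intro member_le_sum) auto
      with N show "x \<in> {- int N..int N}" by auto
    qed
    then show "\<forall>\<^sub>F N in sequentially. finite {- int N..int N} \<and> X \<subseteq> {- int N..int N} \<and> {- int N..int N} \<subseteq> UNIV"
      by (auto intro!: eventually_sequentiallyI)
  qed
  with assms show ?thesis
    unfolding has_sum_def by (rule filterlim_compose)
qed

lemma sum_int_interval_telescope:
  "(\<Sum>k\<in>{- int N..int N}. b k - b (k + 1)) = b (- int N) - (b (int N + 1) :: 'a::ab_group_add)"
proof (induction N)
  case (Suc N)
  have "{- int (Suc N)..int (Suc N)} = insert (- int (Suc N)) (insert (int (Suc N)) {- int N..int N})"
    by auto
  with Suc show ?case by (simp add: algebra_simps)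
qed simp

text \<open>The zeros of \<open>trig 1 x - trig 1 x0\<close> are the translates of x0 by multiples
  of 2 pi. They are simple, and \<phi> - \<phi>(x0) vanishes there by periodicity, so the quotient
  extends continuously.\<close>

lemma test_difference_quotient:
  assumes \<phi>: "\<phi> \<in> test_functions"
  obtains g where "continuous_on UNIV g" "\<And>x. \<phi> x = \<phi> x0 + (trig 1 x - trig 1 x0) * g x"
proof
  \<comment> \<open>At a common zero the quotient of the derivatives is prescribed;
    \<open>- \<i> * trig 1 x\<close> is the derivative of \<open>trig 1\<close>.\<close>
  define g where "g x = (if trig 1 x = trig 1 x0 then fderiv \<phi> x / (- \<i> * trig 1 x)
    else (\<phi> x - \<phi> x0) / (trig 1 x - trig 1 x0))" for x
  have eq: "\<phi> x = \<phi> x0" if "trig 1 x = trig 1 x0" for x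
  proof -
    interpret periodic_fun_simple \<phi> "2 * pi"
      by unfold_locales (simp add: test_periodic[OF \<phi>])
    from that obtain n :: int where "- \<i> * complex_of_real x = - \<i> * of_real x0 + of_int (2 * n) * of_real pi * \<i>"
      by (auto simp: trig_def exp_eq)
    then have "\<i> * complex_of_real x = \<i> * of_real (x0 + of_int (- n) * (2 * pi))"
      by (simp add: algebra_simps)
    then have "x = x0 + of_int (- n) * (2 * pi)"
      using of_real_eq_iff complex_i_not_zero mult_left_cancel by blast
    then show ?thesis using plus_of_int[of x0 "- n"] by simp
  qed
  show "\<phi> x = \<phi> x0 + (trig 1 x - trig 1 x0) * g x" for x
    using eq[of x] by (simp add: g_def)
  have "isCont g x" for x
  proof (cases "trig 1 x = trig 1 x0")
    case False
    have cE: "isCont (trig 1) x" and c\<phi>: "isCont \<phi> x"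
      using continuous_on_trig[of UNIV 1] test_continuous_on[OF \<phi>, of UNIV]
      by (simp_all add: continuous_on_eq_continuous_at)
    then have "\<forall>\<^sub>F y in nhds x. trig 1 y \<noteq> trig 1 x0"
      using False by (intro tendsto_imp_eventually_ne) (auto simp: isCont_def tendsto_at_iff_tendsto_nhds)
    then have "\<forall>\<^sub>F y in nhds x. g y = (\<phi> y - \<phi> x0) / (trig 1 y - trig 1 x0)"
      by eventually_elim (simp add: g_def)
    moreover have "isCont (\<lambda>y. (\<phi> y - \<phi> x0) / (trig 1 y - trig 1 x0)) x"
      using False by (intro continuous_intros cE c\<phi>) auto
    ultimately show ?thesis by (simp add: isCont_cong)
  next
    case True
    have q: "((\<lambda>y. (1 / (y - x)) *\<^sub>R (trig 1 y - trig 1 x)) \<longlongrightarrow> - \<i> * trig 1 x) (at x)"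
      using trig_has_vector_derivative[of 1 x UNIV] by (simp add: has_vector_derivative_iff_quotient)
    have p: "((\<lambda>y. (1 / (y - x)) *\<^sub>R (\<phi> y - \<phi> x)) \<longlongrightarrow> fderiv \<phi> x) (at x)"
      using test_has_fderiv[OF \<phi>] by (simp add: has_vector_derivative_iff_quotient)
    have "((\<lambda>y. ((1 / (y - x)) *\<^sub>R (\<phi> y - \<phi> x)) / ((1 / (y - x)) *\<^sub>R (trig 1 y - trig 1 x)))
        \<longlongrightarrow> fderiv \<phi> x / (- \<i> * trig 1 x)) (at x)"
      by (intro tendsto_divide p q) simp
    \<comment> \<open>The quotient in the denominator has a nonzero limit, so x is the only zero
      nearby and \<open>g y\<close> is given by the second branch; the factors 1 / (y - x)
      cancel.\<close>
    moreover have "\<forall>\<^sub>F y in at x. ((1 / (y - x)) *\<^sub>R (\<phi> y - \<phi> x)) / ((1 / (y - x)) *\<^sub>R (trig 1 y - trig 1 x)) = g y"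
    proof -
      have "\<forall>\<^sub>F y in at x. (1 / (y - x)) *\<^sub>R (trig 1 y - trig 1 x) \<noteq> 0"
        using q by (rule tendsto_imp_eventually_ne) simp
      then show ?thesis
        by eventually_elim (use True eq[OF True] in \<open>auto simp: g_def scaleR_conv_of_real\<close>)
    qed
    ultimately have "(g \<longlongrightarrow> fderiv \<phi> x / (- \<i> * trig 1 x)) (at x)"
      by (rule Lim_transform_eventually)
    then show ?thesis using True by (simp add: isCont_def g_def)
  qed
  then show "continuous_on UNIV g" by (simp add: continuous_on_eq_continuous_at)
qed

lemma test_summable: "\<phi> \<in> test_functions \<Longrightarrow> (\<lambda>k. cmod (test_coeff \<phi> k)) summable_on UNIV"
  using test_coeff_summable_weight[of \<phi> 0] by simp

text \<open>By the factorisation through \<open>g\<close>, the coefficients of \<open>\<phi>\<close> are differences of consecutive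
  coefficients of \<open>g\<close>, so that the series at \<open>x0\<close> telescopes.\<close>

lemma test_Fourier_series:
  assumes \<phi>: "\<phi> \<in> test_functions"
  shows "((\<lambda>k. test_coeff \<phi> k * trig k x0) has_sum \<phi> x0) UNIV"
proof -
  obtain g where g: "continuous_on UNIV g" and eq: "\<And>x. \<phi> x = \<phi> x0 + (trig 1 x - trig 1 x0) * g x"
    using test_difference_quotient[OF \<phi>] by blast
  then have g': "continuous_on {0..2 * pi} g" by (blast intro: continuous_on_subset)
  \<comment> \<open>Chosen so that the term of the series at k is \<open>b k - b (k + 1)\<close>, up
    to the extra value \<phi>(x0) at k = 0.\<close>
  define b where "b k = test_coeff g (k - 1) * trig k x0" for k
  have test_coeff: "test_coeff \<phi> k = (if k = 0 then \<phi> x0 else 0) + test_coeff g (k - 1) - trig 1 x0 * test_coeff g k" for k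
  proof -
    have "\<phi> = (\<lambda>x. \<phi> x0 * 1 + (trig 1 x * g x + (- trig 1 x0) * g x))"
      by (rule ext) (subst eq, simp add: algebra_simps)
    then have "test_coeff \<phi> k = test_coeff (\<lambda>x. \<phi> x0 * 1 + (trig 1 x * g x + (- trig 1 x0) * g x)) k" by (rule arg_cong)
    also have "\<dots> = test_coeff (\<lambda>x. \<phi> x0 * 1) k + (test_coeff (\<lambda>x. trig 1 x * g x) k + test_coeff (\<lambda>x. (- trig 1 x0) * g x) k)"
      using g' by (simp only: test_coeff_add continuous_intros)
    also have "\<dots> = \<phi> x0 * test_coeff (\<lambda>x. 1) k + (test_coeff g (k - 1) + (- trig 1 x0) * test_coeff g k)"
      by (simp only: test_coeff_scale test_coeff_trig_shift)
    finally show ?thesis by (simp add: test_coeff_1)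
  qed
  have coef: "test_coeff \<phi> k * trig k x0 = (if k = 0 then \<phi> x0 else 0) + (b k - b (k + 1))" for k
    using trig_mult[of 1 x0 k] by (simp add: test_coeff b_def algebra_simps)
  \<comment> \<open>Absolute convergence yields an unordered sum \<open>s\<close>; its value can
    then be found along symmetric intervals, where the series telescopes.\<close>
  have "(\<lambda>k. cmod (test_coeff \<phi> k * trig k x0)) summable_on UNIV"
    using test_summable[OF \<phi>] by (simp add: norm_mult)
  then have "(\<lambda>k. test_coeff \<phi> k * trig k x0) summable_on UNIV" by (rule abs_summable_summable)
  then obtain s where s: "((\<lambda>k. test_coeff \<phi> k * trig k x0) has_sum s) UNIV" unfolding summable_on_def ..
  have "(\<lambda>N. \<Sum>k\<in>{- int N..int N}. test_coeff \<phi> k * trig k x0) \<longlonglongrightarrow> s"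
    by (rule has_sum_imp_int_interval_tendsto[OF s])
  moreover have "(\<Sum>k\<in>{- int N..int N}. test_coeff \<phi> k * trig k x0) = \<phi> x0 + (b (- int N) - b (int N + 1))" for N
    unfolding coef sum.distrib sum_int_interval_telescope by simp
  moreover have "(\<lambda>N. b (- int N)) \<longlonglongrightarrow> 0" "(\<lambda>N. b (int N + 1)) \<longlonglongrightarrow> 0"
    using Riemann_Lebesgue[OF g', of "\<lambda>N. - int N - 1"] Riemann_Lebesgue[OF g', of "\<lambda>N. int N"]
    by (subst tendsto_norm_zero_iff[symmetric], simp add: b_def norm_mult tendsto_norm_zero_iff inj_on_def)+
  then have "(\<lambda>N. \<phi> x0 + (b (- int N) - b (int N + 1))) \<longlonglongrightarrow> \<phi> x0 + (0 - 0)"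
    by (intro tendsto_intros)
  ultimately have "s = \<phi> x0" using LIMSEQ_unique by simp
  with s show ?thesis by simp
qed

text \<open>Each derivative is the sum of its own Fourier series, whose coefficients carry the
  factor (- \<i> k)^j; the cruder weight (1 + k^2)^j fits the summability already shown.\<close>

lemma test_seminorm_le_test_coeff:
  assumes \<phi>: "\<phi> \<in> test_functions"
  shows "test_seminorm n \<phi> \<le> (\<Sum>j\<le>n. \<Sum>\<^sub>\<infinity>k. (1 + (real_of_int k)\<^sup>2) ^ j * cmod (test_coeff \<phi> k))"
  unfolding test_seminorm_def
proof (intro sum_mono cSUP_least)
  fix j x
  let ?\<psi> = "(fderiv ^^ j) \<phi>"
  have \<psi>: "?\<psi> \<in> test_functions" using \<phi> by (rule test_funpow_fderiv)
  have "cmod (?\<psi> x) = cmod (\<Sum>\<^sub>\<infinity>k. test_coeff ?\<psi> k * trig k x)"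
    using infsumI[OF test_Fourier_series[OF \<psi>]] by simp
  also have "\<dots> \<le> (\<Sum>\<^sub>\<infinity>k. cmod (test_coeff ?\<psi> k * trig k x))"
    using test_summable[OF \<psi>] by (intro norm_infsum_bound) (simp add: norm_mult)
  also have "\<dots> \<le> (\<Sum>\<^sub>\<infinity>k. (1 + (real_of_int k)\<^sup>2) ^ j * cmod (test_coeff \<phi> k))"
  proof (rule infsum_mono)
    fix k :: int
    have "\<bar>real_of_int k\<bar> \<le> 1 + (real_of_int k)\<^sup>2"
      using sum_squares_bound[of "\<bar>real_of_int k\<bar>" 1] by simp
    then have "\<bar>real_of_int k\<bar> ^ j \<le> (1 + (real_of_int k)\<^sup>2) ^ j"
      by (intro power_mono) auto
    then show "cmod (test_coeff ?\<psi> k * trig k x) \<le> (1 + (real_of_int k)\<^sup>2) ^ j * cmod (test_coeff \<phi> k)"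
      by (simp add: test_coeff_funpow_fderiv[OF \<phi>] norm_mult norm_power mult_right_mono)
  qed (use test_summable[OF \<psi>] test_coeff_summable_weight[OF \<phi>] in \<open>simp_all add: norm_mult\<close>)
  finally show "cmod (?\<psi> x) \<le> (\<Sum>\<^sub>\<infinity>k. (1 + (real_of_int k)\<^sup>2) ^ j * cmod (test_coeff \<phi> k))" .
qed simp

text \<open>The remainder has the coefficients of \<phi> outside \<open>F\<close> and none inside,
  so tails of convergent sums bound its seminorm. The limit is along finite sets of modes, as
  \<open>has_sum\<close> requires.\<close>

lemma test_Fourier_series_seminorm:
  assumes \<phi>: "\<phi> \<in> test_functions"
  shows "((\<lambda>F. test_seminorm n (\<lambda>x. \<phi> x - (\<Sum>k\<in>F. test_coeff \<phi> k * trig k x))) \<longlongrightarrow> 0) (finite_subsets_at_top UNIV)"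
proof (rule tendsto_sandwich)
  let ?w = "\<lambda>j k. (1 + (real_of_int k)\<^sup>2) ^ j * cmod (test_coeff \<phi> k)"
  have S: "(\<lambda>x. \<Sum>k\<in>F. test_coeff \<phi> k * trig k x) \<in> test_functions" for F
    by (intro test_sum test_scale trig_test)
  have R: "(\<lambda>x. \<phi> x - (\<Sum>k\<in>F. test_coeff \<phi> k * trig k x)) \<in> test_functions" for F
    using test_add[OF \<phi> test_scale[OF S, of "- 1" F]] by simp
  show "\<forall>\<^sub>F F in finite_subsets_at_top UNIV. 0 \<le> test_seminorm n (\<lambda>x. \<phi> x - (\<Sum>k\<in>F. test_coeff \<phi> k * trig k x))"
    using test_seminorm_nonneg[OF R] by simp
  show "\<forall>\<^sub>F F in finite_subsets_at_top UNIV. test_seminorm n (\<lambda>x. \<phi> x - (\<Sum>k\<in>F. test_coeff \<phi> k * trig k x))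
      \<le> (\<Sum>j\<le>n. infsum (?w j) UNIV - sum (?w j) F)"
  proof (rule eventually_finite_subsets_at_top_weakI)
    fix F :: "int set" assume F: "finite F"
    have test_coeff: "test_coeff (\<lambda>x. \<phi> x - (\<Sum>k\<in>F. test_coeff \<phi> k * trig k x)) k = (if k \<in> F then 0 else test_coeff \<phi> k)" for k
    proof -
      \<comment> \<open>Subtraction is written with the factor - 1 so that additivity and
        homogeneity of the coefficients apply.\<close>
      have "test_coeff (\<lambda>x. \<phi> x + (- 1) * (\<Sum>k\<in>F. test_coeff \<phi> k * trig k x)) k
          = test_coeff \<phi> k + (- 1) * (\<Sum>j\<in>F. test_coeff \<phi> j * test_coeff (trig j) k)"
        using F by (subst test_coeff_add, intro test_continuous_on \<phi>, intro continuous_intros, unfold test_coeff_scale)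
          (subst test_coeff_sum, simp_all add: test_coeff_scale continuous_intros)
      also have "(\<Sum>j\<in>F. test_coeff \<phi> j * test_coeff (trig j) k) = (\<Sum>j\<in>F. if j = k then test_coeff \<phi> j else 0)"
        by (intro sum.cong) (auto simp: test_coeff_trig)
      finally show ?thesis using F by simp
    qed
    have "(\<Sum>\<^sub>\<infinity>k. (1 + (real_of_int k)\<^sup>2) ^ j * cmod (if k \<in> F then 0 else test_coeff \<phi> k))
        = infsum (?w j) UNIV - sum (?w j) F" for j
    proof -
      have "(\<Sum>\<^sub>\<infinity>k. (1 + (real_of_int k)\<^sup>2) ^ j * cmod (if k \<in> F then 0 else test_coeff \<phi> k))
          = infsum (?w j) (UNIV - F)"
        by (intro infsum_cong_neutral) auto
      also have "\<dots> = infsum (?w j) UNIV - infsum (?w j) F"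
        using test_coeff_summable_weight[OF \<phi>] F by (intro infsum_Diff) auto
      finally show ?thesis using F by simp
    qed
    then show "test_seminorm n (\<lambda>x. \<phi> x - (\<Sum>k\<in>F. test_coeff \<phi> k * trig k x)) \<le> (\<Sum>j\<le>n. infsum (?w j) UNIV - sum (?w j) F)"
      using test_seminorm_le_test_coeff[OF R, of n F] unfolding test_coeff by simp
  qed
  have "((\<lambda>F. \<Sum>j\<le>n. infsum (?w j) UNIV - sum (?w j) F) \<longlongrightarrow> (\<Sum>j\<le>n. infsum (?w j) UNIV - infsum (?w j) UNIV))
      (finite_subsets_at_top UNIV)"
    by (intro tendsto_intros infsum_tendsto test_coeff_summable_weight \<phi>)
  then show "((\<lambda>F. \<Sum>j\<le>n. infsum (?w j) UNIV - sum (?w j) F) \<longlongrightarrow> 0) (finite_subsets_at_top UNIV)"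
    by simp
qed simp

section \<open>Distributions and their Fourier coefficients\<close>

lemma is_distribution_pairing: "is_distribution (pairing u)"
  using pairing by blast

lemma pairing_add:
  "\<phi> \<in> test_functions \<Longrightarrow> \<psi> \<in> test_functions \<Longrightarrow> pairing u (\<lambda>x. \<phi> x + \<psi> x) = pairing u \<phi> + pairing u \<psi>"
  using is_distribution_pairing[of u] by (simp add: is_distribution_def)

lemma pairing_scale: "\<phi> \<in> test_functions \<Longrightarrow> pairing u (\<lambda>x. c * \<phi> x) = c * pairing u \<phi>"
  using is_distribution_pairing[of u] by (simp add: is_distribution_def)

lemma pairing_sum:
  assumes "\<And>i. i \<in> I \<Longrightarrow> f i \<in> test_functions"
  shows "pairing u (\<lambda>x. \<Sum>i\<in>I. f i x) = (\<Sum>i\<in>I. pairing u (f i))"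
proof -
  have "pairing u (\<lambda>x. 0) = 0" using pairing_scale[OF trig_test, of u 0 0] by simp
  then show ?thesis
    using assms by (induction I rule: infinite_finite_induct) (simp_all add: pairing_add test_sum)
qed

lemma fourier_coeff_trig: "fourier_coeff u k = pairing u (trig k) / (2 * pi)"
  by (simp add: fourier_coeff_def trig_def)

section \<open>Distributions as sequences of polynomial growth\<close>

text \<open>A distribution is bounded by some seminorm, in which the finite Fourier sums converge,
  so it may be applied term by term. The factor 2 pi undoes the normalisation in
  \<open>fourier_coeff\<close>.\<close>

lemma pairing_has_sum:
  assumes \<phi>: "\<phi> \<in> test_functions"
  shows "((\<lambda>k. 2 * pi * fourier_coeff u k * test_coeff \<phi> k) has_sum pairing u \<phi>) UNIV"
proof -
  obtain n C where C: "\<And>\<psi>. \<psi> \<in> test_functions \<Longrightarrow> cmod (pairing u \<psi>) \<le> C * test_seminorm n \<psi>"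
    using is_distribution_pairing[of u] unfolding is_distribution_def by metis
  let ?S = "\<lambda>F x. \<Sum>k\<in>F. test_coeff \<phi> k * trig k x"
  have S: "?S F \<in> test_functions" for F
    by (intro test_sum test_scale trig_test)
  have R: "(\<lambda>x. \<phi> x - ?S F x) \<in> test_functions" for F
    using test_add[OF \<phi> test_scale[OF S, of "- 1" F]] by simp
  have split: "(\<Sum>k\<in>F. 2 * pi * fourier_coeff u k * test_coeff \<phi> k) - pairing u \<phi>
      = - pairing u (\<lambda>x. \<phi> x - ?S F x)" for F
  proof -
    have "pairing u \<phi> = pairing u (\<lambda>x. (\<phi> x - ?S F x) + ?S F x)" by simp
    also have "\<dots> = pairing u (\<lambda>x. \<phi> x - ?S F x) + pairing u (?S F)"
      by (rule pairing_add[OF R S])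
    also have "pairing u (?S F) = (\<Sum>k\<in>F. 2 * pi * fourier_coeff u k * test_coeff \<phi> k)"
      by (simp add: pairing_sum[OF test_scale[OF trig_test]] pairing_scale[OF trig_test] fourier_coeff_trig)
        (simp add: mult.commute)
    finally show ?thesis by simp
  qed
  have "((\<lambda>F. C * test_seminorm n (\<lambda>x. \<phi> x - ?S F x)) \<longlongrightarrow> 0) (finite_subsets_at_top UNIV)"
    using tendsto_mult_right_zero[OF test_Fourier_series_seminorm[OF \<phi>]] .
  then have "((\<lambda>F. (\<Sum>k\<in>F. 2 * pi * fourier_coeff u k * test_coeff \<phi> k) - pairing u \<phi>) \<longlongrightarrow> 0) (finite_subsets_at_top UNIV)"
  proof (rule Lim_null_comparison[rotated])
    show "\<forall>\<^sub>F F in finite_subsets_at_top UNIV.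
        cmod ((\<Sum>k\<in>F. 2 * pi * fourier_coeff u k * test_coeff \<phi> k) - pairing u \<phi>)
        \<le> C * test_seminorm n (\<lambda>x. \<phi> x - ?S F x)"
      unfolding split norm_minus_cancel by (intro always_eventually allI C R)
  qed
  then show ?thesis unfolding has_sum_def by (simp add: LIM_zero_iff)
qed

text \<open>On test functions the pairing is a series that involves only the coefficients of the
  distribution; elsewhere both functionals are 0 by normalisation.\<close>

lemma pdistr_eqI:
  assumes "\<And>k. fourier_coeff u k = fourier_coeff v k"
  shows "u = v"
proof -
  have "pairing u \<phi> = pairing v \<phi>" for \<phi>
  proof (cases "\<phi> \<in> test_functions")
    case True
    show ?thesis
      using pairing_has_sum[OF True, of u] pairing_has_sum[OF True, of v] has_sum_unique
      unfolding assms by blast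
  next
    case False
    then show ?thesis
      using is_distribution_pairing[of u] is_distribution_pairing[of v] by (simp add: is_distribution_def)
  qed
  then show ?thesis by (simp add: pairing_inject[symmetric] fun_eq_iff)
qed

text \<open>The functional is defined by the series that a pairing must have. Decay of the test
  coefficients with exponent m + 1 absorbs the growth of \<open>c\<close> and leaves the summable 1
  / (1 + k^2); the same estimate gives continuity in the seminorm of order 2 (m + 1).\<close>

lemma ex_pdistr_fourier_coeff:
  assumes c: "\<And>k. cmod (c k) \<le> C * (1 + (real_of_int k)\<^sup>2) ^ m"
  shows "\<exists>u. \<forall>k. fourier_coeff u k = c k"
proof -
  define u where "u \<phi> = (if \<phi> \<in> test_functions then \<Sum>\<^sub>\<infinity>k. 2 * pi * c k * test_coeff \<phi> k else 0)" for \<phi>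
  have C: "0 \<le> C" using order_trans[OF norm_ge_zero c[of 0]] by simp
  have bound: "cmod (2 * pi * c k * test_coeff \<phi> k) \<le>
      (2 * pi * C * 2 ^ Suc m) * test_seminorm (2 * Suc m) \<phi> * inverse (1 + (real_of_int k)\<^sup>2)"
    if "\<phi> \<in> test_functions" for \<phi> k
  proof -
    let ?w = "1 + (real_of_int k)\<^sup>2"
    have p: "0 < ?w" by (simp add: add_pos_nonneg)
    have "cmod (2 * pi * c k * test_coeff \<phi> k) \<le> 2 * pi * (C * ?w ^ m) * cmod (test_coeff \<phi> k)"
      unfolding norm_mult by (intro mult_mono) (auto simp: c C)
    also have "\<dots> = 2 * pi * C * (?w ^ Suc m * cmod (test_coeff \<phi> k)) * inverse ?w"
      using p by (simp add: field_simps)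
    also have "\<dots> \<le> 2 * pi * C * (2 ^ Suc m * test_seminorm (2 * Suc m) \<phi>) * inverse ?w"
      using p C by (intro mult_right_mono mult_left_mono test_coeff_decay that) auto
    finally show ?thesis by (simp add: mult_ac)
  qed
  have summ: "(\<lambda>k. cmod (2 * pi * c k * test_coeff \<phi> k)) summable_on UNIV" if "\<phi> \<in> test_functions" for \<phi>
    by (rule summable_on_comparison_test[OF summable_on_cmult_right[OF summable_on_inverse_1_plus_square]
          bound[OF that]]) auto
  have summ': "(\<lambda>k. 2 * pi * c k * test_coeff \<phi> k) summable_on UNIV" if "\<phi> \<in> test_functions" for \<phi>
    using summ[OF that] by (rule abs_summable_summable)
  have "is_distribution u"
    unfolding is_distribution_def
  proof (intro conjI ballI allI impI exI)
    fix \<phi> \<psi> assume *: "\<phi> \<in> test_functions" "\<psi> \<in> test_functions"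
    then show "u (\<lambda>x. \<phi> x + \<psi> x) = u \<phi> + u \<psi>"
      using infsum_add[OF summ' summ', of \<phi> \<psi>]
      by (simp add: u_def test_add test_coeff_add test_continuous_on distrib_left)
  next
    fix \<phi> a assume "\<phi> \<in> test_functions"
    then show "u (\<lambda>x. a * \<phi> x) = a * u \<phi>"
      by (simp add: u_def test_scale test_coeff_scale mult.left_commute[of _ a] infsum_cmult_right')
  next
    fix \<phi> assume *: "\<phi> \<in> test_functions"
    let ?B = "(2 * pi * C * 2 ^ Suc m) * test_seminorm (2 * Suc m) \<phi>"
    have "cmod (u \<phi>) \<le> (\<Sum>\<^sub>\<infinity>k. cmod (2 * pi * c k * test_coeff \<phi> k))"
      using * norm_infsum_bound[OF summ[OF *]] by (simp add: u_def)
    also have "\<dots> \<le> (\<Sum>\<^sub>\<infinity>k::int. ?B * inverse (1 + (real_of_int k)\<^sup>2))"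
      using summ[OF *] bound[OF *]
      by (intro infsum_mono summable_on_cmult_right summable_on_inverse_1_plus_square) auto
    also have "\<dots> = (2 * pi * C * 2 ^ Suc m * (\<Sum>\<^sub>\<infinity>k::int. inverse (1 + (real_of_int k)\<^sup>2)))
        * test_seminorm (2 * Suc m) \<phi>"
      by (subst infsum_cmult_right') (simp add: mult_ac)
    finally show "cmod (u \<phi>) \<le> \<dots>" .
  qed (simp add: u_def)
  then have p: "pairing (Abs_pdistr u) = u" by (simp add: Abs_pdistr_inverse)
  have "fourier_coeff (Abs_pdistr u) j = c j" for j
  proof -
    have "u (trig j) = (\<Sum>\<^sub>\<infinity>k\<in>{j}. 2 * pi * c k * test_coeff (trig j) k)"
      unfolding u_def by (simp only: trig_test if_True) (rule infsum_cong_neutral, auto simp: test_coeff_trig)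
    then show ?thesis by (simp add: fourier_coeff_trig p test_coeff_trig)
  qed
  then show ?thesis by blast
qed

section \<open>Operations on distributions, read off from the coefficients\<close>

lemma fourier_coeff_0 [simp]: "fourier_coeff 0 k = 0"
  by (simp add: fourier_coeff_def zero_pdistr.rep_eq)

lemma fourier_coeff_add [simp]: "fourier_coeff (f + g) k = fourier_coeff f k + fourier_coeff g k"
  by (simp add: fourier_coeff_def plus_pdistr.rep_eq add_divide_distrib)

lemma fourier_coeff_diff [simp]: "fourier_coeff (f - g) k = fourier_coeff f k - fourier_coeff g k"
  by (simp add: fourier_coeff_def minus_pdistr.rep_eq diff_divide_distrib)

lemma fourier_coeff_uminus [simp]: "fourier_coeff (- f) k = - fourier_coeff f k"
  by (simp add: fourier_coeff_def uminus_pdistr.rep_eq)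

lemma fourier_coeff_scaleR [simp]: "fourier_coeff (a *\<^sub>R f) k = a *\<^sub>R fourier_coeff f k"
  by (simp add: fourier_coeff_def scaleR_pdistr.rep_eq scaleR_conv_of_real)

lemma fourier_coeff_cscale [simp]: "fourier_coeff (cscale c f) k = c * fourier_coeff f k"
  by (simp add: fourier_coeff_def cscale.rep_eq)

text \<open>The sign in the definition of \<open>ddx\<close> and that in the exponent of
  \<open>trig k\<close> cancel, which leaves the usual symbol \<i> k.\<close>

lemma fourier_coeff_ddx [simp]: "fourier_coeff (ddx f) k = \<i> * of_int k * fourier_coeff f k"
proof -
  have "fderiv (trig k) = (\<lambda>x. - \<i> * of_int k * trig k x)"
    unfolding fderiv_def using vector_derivative_at[OF trig_has_vector_derivative] by blast
  then have "pairing f (fderiv (trig k)) = - \<i> * of_int k * pairing f (trig k)"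
    by (simp only: pairing_scale[OF trig_test])
  then show ?thesis by (simp add: fourier_coeff_trig ddx.rep_eq trig_test)
qed

section \<open>Sobolev norms\<close>

text \<open>The power \<open>r\<close> of the Japanese bracket of \<open>k\<close>.\<close>

definition bracket :: "real \<Rightarrow> int \<Rightarrow> real" where
  "bracket r k = (1 + (real_of_int k)\<^sup>2) powr (r / 2)"

lemma one_plus_square_pos [simp]: "0 < 1 + (x::real)\<^sup>2"
  by (simp add: add_pos_nonneg)

lemma one_plus_square_nonzero [simp]: "1 + (x::real)\<^sup>2 \<noteq> 0"
  using one_plus_square_pos[of x] by linarith

lemma bracket_pos [simp]: "0 < bracket r k"
  using one_plus_square_pos[of "real_of_int k"] unfolding bracket_def powr_gt_zero by linarith

lemma bracket_nonneg [simp]: "0 \<le> bracket r k"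
  by (simp add: less_imp_le)

lemma bracket_add: "bracket (a + b) k = bracket a k * bracket b k"
  by (simp add: bracket_def powr_add add_divide_distrib)

lemma bracket_mono: "a \<le> b \<Longrightarrow> bracket a k \<le> bracket b k"
  unfolding bracket_def by (intro powr_mono) auto

lemma bracket_square: "(bracket r k)\<^sup>2 = (1 + (real_of_int k)\<^sup>2) powr r"
  by (simp add: bracket_def power2_eq_square powr_add[symmetric])

lemma bracket_2: "bracket 2 k = 1 + (real_of_int k)\<^sup>2"
  by (simp add: bracket_def powr_one)

lemma bracket_1: "bracket 1 k = sqrt (1 + (real_of_int k)\<^sup>2)"
  by (simp add: bracket_def powr_half_sqrt)

lemma abs_le_bracket_1: "\<bar>real_of_int k\<bar> \<le> bracket 1 k"
  unfolding bracket_1 by (rule real_le_rsqrt) simp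

lemma bracket_1_le: "bracket 1 k \<le> 1 + \<bar>real_of_int k\<bar>"
  unfolding bracket_1 by (rule real_le_lsqrt) (auto simp: power2_eq_square algebra_simps)

lemma sobolev_iff:
  "f \<in> sobolev r \<longleftrightarrow> (\<lambda>k. (bracket r k * cmod (fourier_coeff f k))\<^sup>2) summable_on UNIV"
  by (simp add: sobolev_def power_mult_distrib bracket_square)

lemma sobolev_norm_eq:
  "sobolev_norm r f = sqrt (2 * pi * (\<Sum>\<^sub>\<infinity>k. (bracket r k * cmod (fourier_coeff f k))\<^sup>2))"
  by (simp add: sobolev_norm_def power_mult_distrib bracket_square)

lemma sobolev_norm_nonneg [simp]: "0 \<le> sobolev_norm r f"
  by (simp add: sobolev_norm_eq infsum_nonneg)

text \<open>A single term of a nonnegative series is at most the sum, and the factor 2 pi > 1 only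
  enlarges the norm.\<close>

lemma fourier_coeff_le_sobolev_norm:
  assumes "f \<in> sobolev r"
  shows "bracket r k * cmod (fourier_coeff f k) \<le> sobolev_norm r f"
proof -
  let ?s = "\<lambda>k. (bracket r k * cmod (fourier_coeff f k))\<^sup>2"
  have "?s k \<le> infsum ?s UNIV"
    using finite_sum_le_infsum[of ?s UNIV "{k}"] assms by (simp add: sobolev_iff)
  also have "\<dots> = 1 * infsum ?s UNIV" by simp
  also have "\<dots> \<le> 2 * pi * infsum ?s UNIV"
    using pi_gt3 by (intro mult_right_mono infsum_nonneg) auto
  finally show ?thesis unfolding sobolev_norm_eq by (rule real_le_rsqrt)
qed

section \<open>Square-summable majorants and comparison of Sobolev norms\<close>

definition square_summable :: "(int \<Rightarrow> real) \<Rightarrow> bool" where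
  "square_summable B \<longleftrightarrow> (\<lambda>k. (B k)\<^sup>2) summable_on UNIV"

lemma sobolev_square_summable:
  "f \<in> sobolev r \<Longrightarrow> square_summable (\<lambda>k. bracket r k * cmod (fourier_coeff f k))"
  by (simp add: sobolev_iff square_summable_def)

lemma square_summable_scale: "square_summable a \<Longrightarrow> square_summable (\<lambda>k. c * a k)"
  unfolding square_summable_def by (simp add: power_mult_distrib summable_on_cmult_right)

lemma square_sum_le: "((a::real) + b)\<^sup>2 \<le> 2 * a\<^sup>2 + 2 * b\<^sup>2"
  using zero_le_power2[of "a - b"] by (simp add: power2_eq_square algebra_simps)

lemma square_summable_add:
  assumes "square_summable a" "square_summable b"
  shows "square_summable (\<lambda>k. a k + b k)"
  unfolding square_summable_def
proof (rule summable_on_comparison_test)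
  show "(\<lambda>k. 2 * (a k)\<^sup>2 + 2 * (b k)\<^sup>2) summable_on UNIV"
    using assms unfolding square_summable_def by (intro summable_on_add summable_on_cmult_right)
qed (auto intro: square_sum_le)

lemma sobolevI:
  assumes "square_summable B" "\<And>k. bracket r k * cmod (fourier_coeff f k) \<le> B k"
  shows "f \<in> sobolev r"
  unfolding sobolev_iff
proof (rule summable_on_comparison_test)
  show "(\<lambda>k. (B k)\<^sup>2) summable_on UNIV" using assms(1) by (simp add: square_summable_def)
qed (auto intro!: power_mono assms(2))

text \<open>Transfers a bound on every mode to the norms. There are two source functions because the
  propagator couples the second and third components. The inequality \<open>square_sum_le\<close>
  takes the place of the triangle inequality of the norm and costs a factor sqrt 2, rounded up to
  2.\<close>

lemma sobolev_norm_le: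
  assumes f: "\<And>k. bracket r k * cmod (fourier_coeff f k)
      \<le> C * (bracket a k * cmod (fourier_coeff g k) + bracket b k * cmod (fourier_coeff h k))"
    and g: "g \<in> sobolev a" and h: "h \<in> sobolev b" and C: "0 \<le> C"
  shows "f \<in> sobolev r" "sobolev_norm r f \<le> 2 * C * (sobolev_norm a g + sobolev_norm b h)"
proof -
  let ?g = "\<lambda>k. bracket a k * cmod (fourier_coeff g k)" and ?h = "\<lambda>k. bracket b k * cmod (fourier_coeff h k)"
  let ?f = "\<lambda>k. bracket r k * cmod (fourier_coeff f k)"
  have gs: "(\<lambda>k. (?g k)\<^sup>2) summable_on UNIV" and hs: "(\<lambda>k. (?h k)\<^sup>2) summable_on UNIV"
    using g h by (simp_all add: sobolev_iff)
  show f': "f \<in> sobolev r"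
    by (rule sobolevI[OF square_summable_scale[OF square_summable_add] f])
      (intro sobolev_square_summable g h)+
  have fin: "(?f k)\<^sup>2 \<le> 2 * C\<^sup>2 * ((?g k)\<^sup>2 + (?h k)\<^sup>2)" for k
  proof -
    have "(?f k)\<^sup>2 \<le> (C * (?g k + ?h k))\<^sup>2" by (intro power_mono f) simp
    also have "\<dots> \<le> C\<^sup>2 * (2 * (?g k)\<^sup>2 + 2 * (?h k)\<^sup>2)"
      unfolding power_mult_distrib[of C] by (intro mult_left_mono square_sum_le) simp
    finally show ?thesis by (simp add: algebra_simps)
  qed
  have "(\<Sum>\<^sub>\<infinity>k. (?f k)\<^sup>2) \<le> (\<Sum>\<^sub>\<infinity>k. 2 * C\<^sup>2 * ((?g k)\<^sup>2 + (?h k)\<^sup>2))"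
    using f' fin gs hs unfolding sobolev_iff
    by (intro infsum_mono summable_on_cmult_right summable_on_add)
  also have "\<dots> = 2 * C\<^sup>2 * ((\<Sum>\<^sub>\<infinity>k. (?g k)\<^sup>2) + (\<Sum>\<^sub>\<infinity>k. (?h k)\<^sup>2))"
    using gs hs by (simp add: infsum_cmult_right' infsum_add)
  finally have "2 * pi * (\<Sum>\<^sub>\<infinity>k. (?f k)\<^sup>2)
      \<le> 2 * pi * (2 * C\<^sup>2 * ((\<Sum>\<^sub>\<infinity>k. (?g k)\<^sup>2) + (\<Sum>\<^sub>\<infinity>k. (?h k)\<^sup>2)))"
    by (intro mult_left_mono) auto
  also have "\<dots> = 2 * C\<^sup>2 * ((sobolev_norm a g)\<^sup>2 + (sobolev_norm b h)\<^sup>2)"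
    by (simp add: sobolev_norm_eq infsum_nonneg algebra_simps)
  also have "\<dots> \<le> 2 * C\<^sup>2 * (sobolev_norm a g + sobolev_norm b h)\<^sup>2"
    by (intro mult_left_mono) (auto simp: power2_eq_square algebra_simps)
  also have "\<dots> \<le> (2 * C * (sobolev_norm a g + sobolev_norm b h))\<^sup>2"
    by (simp add: power_mult_distrib mult_right_mono)
  finally show "sobolev_norm r f \<le> 2 * C * (sobolev_norm a g + sobolev_norm b h)"
    unfolding sobolev_norm_eq[of r f] using C by (intro real_le_lsqrt) auto
qed

lemma sobolev_0 [simp]: "0 \<in> sobolev r"
  by (simp add: sobolev_iff)

lemma sobolev_norm_0 [simp]: "sobolev_norm r 0 = 0"
  by (simp add: sobolev_norm_eq)

lemma sobolev_norm_le_single: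
  assumes "\<And>k. bracket r k * cmod (fourier_coeff f k) \<le> C * (bracket a k * cmod (fourier_coeff g k))"
    and "g \<in> sobolev a" "0 \<le> C"
  shows "f \<in> sobolev r" "sobolev_norm r f \<le> 2 * C * sobolev_norm a g"
  using sobolev_norm_le[where h = 0 and b = 0, of r f C a g] assms by simp_all

lemma sobolev_diff:
  assumes "f \<in> sobolev r" "g \<in> sobolev r"
  shows "f - g \<in> sobolev r"
proof (rule sobolev_norm_le(1)[where C = 1])
  show "bracket r k * cmod (fourier_coeff (f - g) k)
      \<le> 1 * (bracket r k * cmod (fourier_coeff f k) + bracket r k * cmod (fourier_coeff g k))" for k
    using norm_triangle_ineq4[of "fourier_coeff f k" "fourier_coeff g k"]
    by (simp add: distrib_left[symmetric])
qed (use assms in auto)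

lemma sobolev_mono:
  assumes "f \<in> sobolev a" "b \<le> a"
  shows "f \<in> sobolev b" "sobolev_norm b f \<le> 2 * sobolev_norm a f"
  using sobolev_norm_le_single[of b f 1 a f] assms bracket_mono[of b a] by (simp_all add: mult_right_mono)

section \<open>Continuity and differentiability in time by domination over the modes\<close>

text \<open>A finite set \<open>K\<close> carries the sum of \<open>B\<close> up to e / 2; on
  \<open>K\<close> termwise convergence suffices, off \<open>K\<close> the tail of \<open>B\<close>
  bounds the rest.\<close>

lemma infsum_dominated_tendsto_0:
  fixes h :: "'b \<Rightarrow> 'a \<Rightarrow> real"
  assumes B: "B summable_on UNIV" and le: "\<forall>\<^sub>F \<tau> in F. \<forall>k. 0 \<le> h \<tau> k \<and> h \<tau> k \<le> B k"
    and lim: "\<And>k. ((\<lambda>\<tau>. h \<tau> k) \<longlongrightarrow> 0) F"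
  shows "((\<lambda>\<tau>. infsum (h \<tau>) UNIV) \<longlongrightarrow> 0) F"
proof (rule tendstoI)
  fix e :: real assume e: "0 < e"
  obtain K where K: "finite K" "dist (sum B K) (infsum B UNIV) \<le> e / 2"
    using infsum_finite_approximation[OF B, of "e / 2"] e by auto
  have "((\<lambda>\<tau>. \<Sum>k\<in>K. h \<tau> k) \<longlongrightarrow> (\<Sum>k\<in>K. 0)) F" by (intro tendsto_sum lim)
  then have "\<forall>\<^sub>F \<tau> in F. (\<Sum>k\<in>K. h \<tau> k) < e / 2"
    using e by (intro order_tendstoD(2)) auto
  with le show "\<forall>\<^sub>F \<tau> in F. dist (infsum (h \<tau>) UNIV) 0 < e"
  proof eventually_elim
    case (elim \<tau>)
    then have s: "h \<tau> summable_on UNIV"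
      by (intro summable_on_comparison_test[OF B]) auto
    have "infsum (h \<tau>) UNIV - sum (h \<tau>) K = infsum (h \<tau>) (UNIV - K)"
      using infsum_Diff[OF s, of K] K(1) by simp
    also have "\<dots> \<le> infsum B (UNIV - K)"
      using s B K(1) elim by (intro infsum_mono summable_on_Diff) auto
    also have "\<dots> = infsum B UNIV - sum B K"
      using infsum_Diff[OF B, of K] K(1) by simp
    also have "\<dots> \<le> e / 2" using K(2) unfolding dist_real_def by linarith
    finally show ?case using elim infsum_nonneg[of UNIV "h \<tau>"] by (simp add: dist_real_def)
  qed
qed

lemma converges_in_sobolevI:
  assumes l: "l \<in> sobolev r" and f: "\<forall>\<^sub>F \<tau> in F. f \<tau> \<in> sobolev r"
    and lim: "\<And>k. ((\<lambda>\<tau>. fourier_coeff (f \<tau>) k) \<longlongrightarrow> fourier_coeff l k) F"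
    and B: "square_summable B"
    and le: "\<forall>\<^sub>F \<tau> in F. \<forall>k. bracket r k * cmod (fourier_coeff (f \<tau>) k - fourier_coeff l k) \<le> B k"
  shows "converges_in (sobolev r) (sobolev_norm r) f l F"
proof -
  let ?h = "\<lambda>\<tau> k. (bracket r k * cmod (fourier_coeff (f \<tau>) k - fourier_coeff l k))\<^sup>2"
  have "((\<lambda>\<tau>. infsum (?h \<tau>) UNIV) \<longlongrightarrow> 0) F"
  proof (rule infsum_dominated_tendsto_0)
    show "(\<lambda>k. (B k)\<^sup>2) summable_on UNIV" using B by (simp add: square_summable_def)
    show "\<forall>\<^sub>F \<tau> in F. \<forall>k. 0 \<le> ?h \<tau> k \<and> ?h \<tau> k \<le> (B k)\<^sup>2"
      using le by eventually_elim (auto intro: power_mono)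
    show "((\<lambda>\<tau>. ?h \<tau> k) \<longlongrightarrow> 0) F" for k
      using tendsto_power[OF tendsto_mult[OF tendsto_const[of "bracket r k"]
            tendsto_norm[OF tendsto_diff[OF lim[of k] tendsto_const[of "fourier_coeff l k"]]]], of 2]
      by simp
  qed
  from tendsto_real_sqrt[OF tendsto_mult[OF tendsto_const[of "2 * pi"] this]]
  have "((\<lambda>\<tau>. sobolev_norm r (f \<tau> - l)) \<longlongrightarrow> 0) F"
    by (simp add: sobolev_norm_eq)
  with l f show ?thesis by (simp add: converges_in_def)
qed

text \<open>The norm controls each coefficient. Eventual membership matters here, since a divergent
  sum would give the norm the value 0.\<close>

lemma converges_in_sobolev_fourier_coeff:
  assumes "converges_in (sobolev r) (sobolev_norm r) f l F"
  shows "((\<lambda>\<tau>. fourier_coeff (f \<tau>) k) \<longlongrightarrow> fourier_coeff l k) F"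
proof -
  have l: "l \<in> sobolev r" and f: "\<forall>\<^sub>F \<tau> in F. f \<tau> \<in> sobolev r"
    and lim: "((\<lambda>\<tau>. sobolev_norm r (f \<tau> - l)) \<longlongrightarrow> 0) F"
    using assms by (auto simp: converges_in_def)
  have "((\<lambda>\<tau>. fourier_coeff (f \<tau>) k - fourier_coeff l k) \<longlongrightarrow> 0) F"
  proof (rule Lim_null_comparison)
    show "\<forall>\<^sub>F \<tau> in F. cmod (fourier_coeff (f \<tau>) k - fourier_coeff l k) \<le> sobolev_norm r (f \<tau> - l) / bracket r k"
      using f
    proof eventually_elim
      case (elim \<tau>)
      show ?case using fourier_coeff_le_sobolev_norm[OF sobolev_diff[OF elim l], of k]
        by (simp add: pos_le_divide_eq mult.commute)
    qed
    show "((\<lambda>\<tau>. sobolev_norm r (f \<tau> - l) / bracket r k) \<longlongrightarrow> 0) F"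
      using tendsto_divide[OF lim tendsto_const[of "bracket r k"]] bracket_pos[of r k] by simp
  qed
  then show ?thesis by (simp add: LIM_zero_iff)
qed

text \<open>Turns an evolution equation in a Sobolev space into scalar differential equations, one
  for each mode; uniqueness rests on this.\<close>

lemma has_time_derivative_sobolev_fourier_coeff:
  assumes "has_time_derivative (sobolev r) (sobolev_norm r) f d t"
  shows "((\<lambda>\<tau>. fourier_coeff (f \<tau>) k) has_vector_derivative fourier_coeff d k) (at t within {0..})"
  using converges_in_sobolev_fourier_coeff[OF assms[unfolded has_time_derivative_def], of k]
  by (simp add: has_vector_derivative_iff_quotient)

text \<open>A majorant common to all times in [0, T] is stronger than a bound on the norms, and it
  is what dominated convergence over the modes consumes. Negative times stay unconstrained.\<close>

definition locally_dominated :: "real \<Rightarrow> (real \<Rightarrow> pdistr) \<Rightarrow> bool" where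
  "locally_dominated r f \<longleftrightarrow> (\<forall>T. \<exists>B. square_summable B \<and>
     (\<forall>t\<in>{0..T}. \<forall>k. bracket r k * cmod (fourier_coeff (f t) k) \<le> B k))"

lemma locally_dominated_sobolev:
  assumes "locally_dominated r f" "0 \<le> t"
  shows "f t \<in> sobolev r"
proof -
  obtain B where "square_summable B" "\<forall>\<tau>\<in>{0..t}. \<forall>k. bracket r k * cmod (fourier_coeff (f \<tau>) k) \<le> B k"
    using assms unfolding locally_dominated_def by blast
  with assms(2) show ?thesis by (intro sobolevI[of B]) auto
qed

text \<open>Supplies a fixed bounded interval, one-sided at t = 0, on which one majorant serves all
  nearby times; \<open>\<tau> \<noteq> t\<close> permits division by
  \<open>\<tau> - t\<close>.\<close>

lemma eventually_at_within_nonneg: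
  "0 \<le> (t::real) \<Longrightarrow> \<forall>\<^sub>F \<tau> in at t within {0..}. \<tau> \<in> {0..t + 1} \<and> \<tau> \<noteq> t"
  unfolding eventually_at by (rule exI[of _ 1]) (auto simp: dist_real_def)

text \<open>Lifts continuity of each coefficient to the norm. The majorant is doubled because the
  values at \<open>\<tau>\<close> and at \<open>t\<close> are each bounded by
  \<open>B\<close>.\<close>

lemma C0_curve_sobolevI:
  assumes dom: "locally_dominated r f"
    and cont: "\<And>t k. 0 \<le> t \<Longrightarrow>
      ((\<lambda>\<tau>. fourier_coeff (f \<tau>) k) \<longlongrightarrow> fourier_coeff (f t) k) (at t within {0..})"
  shows "C0_curve (sobolev r) (sobolev_norm r) f"
  unfolding C0_curve_def
proof (intro allI impI conjI)
  fix t :: real assume t: "0 \<le> t"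
  note ev = eventually_at_within_nonneg[OF t]
  show ft: "f t \<in> sobolev r" using dom t by (rule locally_dominated_sobolev)
  obtain B where B: "square_summable B"
    "\<And>\<tau> k. \<tau> \<in> {0..t + 1} \<Longrightarrow> bracket r k * cmod (fourier_coeff (f \<tau>) k) \<le> B k"
    using dom unfolding locally_dominated_def by meson
  show "converges_in (sobolev r) (sobolev_norm r) f (f t) (at t within {0..})"
  proof (rule converges_in_sobolevI[OF ft _ cont[OF t] square_summable_scale[OF B(1), of 2]])
    show "\<forall>\<^sub>F \<tau> in at t within {0..}. f \<tau> \<in> sobolev r"
      using ev by eventually_elim (auto intro: locally_dominated_sobolev[OF dom])
    show "\<forall>\<^sub>F \<tau> in at t within {0..}. \<forall>k. bracket r k * cmod (fourier_coeff (f \<tau>) k - fourier_coeff (f t) k) \<le> 2 * B k"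
      using ev
    proof (eventually_elim, intro allI)
      fix \<tau> k assume \<tau>: "\<tau> \<in> {0..t + 1} \<and> \<tau> \<noteq> t"
      have "bracket r k * cmod (fourier_coeff (f \<tau>) k - fourier_coeff (f t) k)
          \<le> bracket r k * (cmod (fourier_coeff (f \<tau>) k) + cmod (fourier_coeff (f t) k))"
        by (intro mult_left_mono norm_triangle_ineq4) simp
      then show "bracket r k * cmod (fourier_coeff (f \<tau>) k - fourier_coeff (f t) k) \<le> 2 * B k"
        using B(2)[of \<tau> k] B(2)[of t k] \<tau> t by (simp add: distrib_left)
    qed
  qed
qed

text \<open>The mean value inequality in each mode bounds the difference quotient by the majorant of
  \<open>d\<close>. The order in which the derivative is dominated thus decides in which space the
  quotients converge.\<close>

lemma has_time_derivative_sobolevI: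
  assumes f: "locally_dominated r f" and d: "locally_dominated r d" and t: "0 \<le> t"
    and deriv: "\<And>t k. 0 \<le> t \<Longrightarrow>
      ((\<lambda>\<tau>. fourier_coeff (f \<tau>) k) has_vector_derivative fourier_coeff (d t) k) (at t within {0..})"
  shows "has_time_derivative (sobolev r) (sobolev_norm r) f (d t) t"
  unfolding has_time_derivative_def
proof -
  note ev = eventually_at_within_nonneg[OF t]
  let ?q = "\<lambda>\<tau>. (1 / (\<tau> - t)) *\<^sub>R (f \<tau> - f t)"
  obtain B where B: "square_summable B"
    "\<And>\<tau> k. \<tau> \<in> {0..t + 1} \<Longrightarrow> bracket r k * cmod (fourier_coeff (d \<tau>) k) \<le> B k"
    using d unfolding locally_dominated_def by meson
  have q: "bracket r k * cmod (fourier_coeff (?q \<tau>) k) \<le> B k" if \<tau>: "\<tau> \<in> {0..t + 1}" "\<tau> \<noteq> t" for \<tau> k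
  proof -
    have "cmod (fourier_coeff (f \<tau>) k - fourier_coeff (f t) k) \<le> (B k / bracket r k) * norm (\<tau> - t)"
    proof (rule differentiable_bound[where f' = "\<lambda>s h. h *\<^sub>R fourier_coeff (d s) k"])
      fix s assume s: "s \<in> {0..t + 1}"
      show "((\<lambda>\<tau>. fourier_coeff (f \<tau>) k) has_derivative (\<lambda>h. h *\<^sub>R fourier_coeff (d s) k)) (at s within {0..t + 1})"
        using has_vector_derivative_within_subset[OF deriv[of s k], of "{0..t + 1}"] s
        by (simp add: has_vector_derivative_def subset_iff)
      have "cmod (fourier_coeff (d s) k) \<le> B k / bracket r k"
        using B(2)[OF s, of k] by (simp add: pos_le_divide_eq mult.commute)
      then show "onorm (\<lambda>h. h *\<^sub>R fourier_coeff (d s) k) \<le> B k / bracket r k"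
        by (intro onorm_le) (auto dest: mult_left_mono[OF _ abs_ge_zero] simp: mult.commute)
    qed (use \<tau> t in auto)
    then have "bracket r k * cmod (fourier_coeff (f \<tau>) k - fourier_coeff (f t) k) \<le> B k * \<bar>\<tau> - t\<bar>"
      using bracket_pos[of r k] by (simp add: field_simps)
    then have "\<bar>1 / (\<tau> - t)\<bar> * (bracket r k * cmod (fourier_coeff (f \<tau>) k - fourier_coeff (f t) k))
        \<le> \<bar>1 / (\<tau> - t)\<bar> * (B k * \<bar>\<tau> - t\<bar>)"
      by (rule mult_left_mono) simp
    then show ?thesis
      using \<tau>(2) by (simp add: scaleR_diff_right[symmetric] mult.left_commute)
  qed
  show "converges_in (sobolev r) (sobolev_norm r) ?q (d t) (at t within {0..})"
  proof (rule converges_in_sobolevI[OF _ _ _ square_summable_scale[OF B(1), of 2]])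
    show "d t \<in> sobolev r" using d t by (rule locally_dominated_sobolev)
    show "\<forall>\<^sub>F \<tau> in at t within {0..}. ?q \<tau> \<in> sobolev r"
      using ev by eventually_elim (auto intro!: sobolevI[OF B(1)] q)
    show "((\<lambda>\<tau>. fourier_coeff (?q \<tau>) k) \<longlongrightarrow> fourier_coeff (d t) k) (at t within {0..})" for k
      using deriv[OF t, of k] by (simp add: has_vector_derivative_iff_quotient)
    show "\<forall>\<^sub>F \<tau> in at t within {0..}. \<forall>k. bracket r k * cmod (fourier_coeff (?q \<tau>) k - fourier_coeff (d t) k) \<le> 2 * B k"
      using ev
    proof (eventually_elim, intro allI)
      fix \<tau> k assume \<tau>: "\<tau> \<in> {0..t + 1} \<and> \<tau> \<noteq> t"
      have "bracket r k * cmod (fourier_coeff (?q \<tau>) k - fourier_coeff (d t) k)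
          \<le> bracket r k * (cmod (fourier_coeff (?q \<tau>) k) + cmod (fourier_coeff (d t) k))"
        by (intro mult_left_mono norm_triangle_ineq4) simp
      also have "\<dots> \<le> 2 * B k"
        using q[of \<tau> k] B(2)[of t k] \<tau> t unfolding distrib_left by auto
      finally show "bracket r k * cmod (fourier_coeff (?q \<tau>) k - fourier_coeff (d t) k) \<le> 2 * B k" .
    qed
  qed
qed

lemma sobolev3_norm_eq:
  "sobolev3_norm a b c f = sobolev_norm a (fst f) + sobolev_norm b (fst (snd f)) + sobolev_norm c (snd (snd f))"
  by (cases f) simp

lemma sobolev3_iff:
  "f \<in> sobolev3 a b c \<longleftrightarrow> fst f \<in> sobolev a \<and> fst (snd f) \<in> sobolev b \<and> snd (snd f) \<in> sobolev c"
  by (cases f) (simp add: sobolev3_def)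

text \<open>The three parts of the norm are nonnegative, so their sum tends to 0 only if each part
  does.\<close>

lemma converges_in_sobolev3:
  "converges_in (sobolev3 a b c) (sobolev3_norm a b c) f l F \<longleftrightarrow>
     converges_in (sobolev a) (sobolev_norm a) (\<lambda>t. fst (f t)) (fst l) F \<and>
     converges_in (sobolev b) (sobolev_norm b) (\<lambda>t. fst (snd (f t))) (fst (snd l)) F \<and>
     converges_in (sobolev c) (sobolev_norm c) (\<lambda>t. snd (snd (f t))) (snd (snd l)) F"
proof -
  let ?u = "\<lambda>t. sobolev_norm a (fst (f t) - fst l)"
    and ?v = "\<lambda>t. sobolev_norm b (fst (snd (f t)) - fst (snd l))"
    and ?w = "\<lambda>t. sobolev_norm c (snd (snd (f t)) - snd (snd l))"
  have "((\<lambda>t. ?u t + ?v t + ?w t) \<longlongrightarrow> 0) F \<longleftrightarrow> (?u \<longlongrightarrow> 0) F \<and> (?v \<longlongrightarrow> 0) F \<and> (?w \<longlongrightarrow> 0) F"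
  proof
    assume *: "((\<lambda>t. ?u t + ?v t + ?w t) \<longlongrightarrow> 0) F"
    show "(?u \<longlongrightarrow> 0) F \<and> (?v \<longlongrightarrow> 0) F \<and> (?w \<longlongrightarrow> 0) F"
      by (intro conjI; rule tendsto_sandwich[OF _ _ tendsto_const *]) (simp_all add: add_nonneg_nonneg)
  next
    assume "(?u \<longlongrightarrow> 0) F \<and> (?v \<longlongrightarrow> 0) F \<and> (?w \<longlongrightarrow> 0) F"
    then show "((\<lambda>t. ?u t + ?v t + ?w t) \<longlongrightarrow> 0) F"
      using tendsto_add[OF tendsto_add[of ?u 0 F ?v 0], of ?w 0] by simp
  qed
  then show ?thesis
    by (auto simp: converges_in_def sobolev3_iff sobolev3_norm_eq eventually_conj_iff)
qed

lemma C0_curve_sobolev3: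
  "C0_curve (sobolev3 a b c) (sobolev3_norm a b c) f \<longleftrightarrow>
     C0_curve (sobolev a) (sobolev_norm a) (\<lambda>t. fst (f t)) \<and>
     C0_curve (sobolev b) (sobolev_norm b) (\<lambda>t. fst (snd (f t))) \<and>
     C0_curve (sobolev c) (sobolev_norm c) (\<lambda>t. snd (snd (f t)))"
  by (auto simp: C0_curve_def converges_in_sobolev3 sobolev3_iff)

lemma has_time_derivative_sobolev3:
  "has_time_derivative (sobolev3 a b c) (sobolev3_norm a b c) f d t \<longleftrightarrow>
     has_time_derivative (sobolev a) (sobolev_norm a) (\<lambda>t. fst (f t)) (fst d) t \<and>
     has_time_derivative (sobolev b) (sobolev_norm b) (\<lambda>t. fst (snd (f t))) (fst (snd d)) t \<and>
     has_time_derivative (sobolev c) (sobolev_norm c) (\<lambda>t. snd (snd (f t))) (snd (snd d)) t"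
  by (simp add: has_time_derivative_def converges_in_sobolev3)

lemma bracket_even_nat: "bracket (2 * real m) k = (1 + (real_of_int k)\<^sup>2) ^ m"
  by (simp add: bracket_def powr_realpow)

text \<open>The root of the sum of squares bounds every weighted coefficient, and removing the
  weight costs at most a polynomial factor.\<close>

lemma ex_pdistr_sobolev:
  assumes B: "square_summable B" and le: "\<And>k. bracket r k * cmod (c k) \<le> B k"
  shows "\<exists>u. \<forall>k. fourier_coeff u k = c k"
proof -
  define b where "b = sqrt (\<Sum>\<^sub>\<infinity>k. (B k)\<^sup>2)"
  have b: "0 \<le> b" by (simp add: b_def infsum_nonneg)
  have Bb: "B k \<le> b" for k
    unfolding b_def using B finite_sum_le_infsum[of "\<lambda>k. (B k)\<^sup>2" UNIV "{k}"]
    by (intro real_le_rsqrt) (simp add: square_summable_def)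
  \<comment> \<open>Polynomial growth is stated with a natural exponent; this one satisfies - r
    \<le> 2 m.\<close>
  define m where "m = nat \<lceil>\<bar>r\<bar>\<rceil>"
  have "cmod (c k) \<le> b * (1 + (real_of_int k)\<^sup>2) ^ m" for k
  proof -
    have "bracket (- r) k * bracket r k = 1"
      by (simp add: bracket_add[symmetric]) (simp add: bracket_def)
    then have "cmod (c k) = bracket (- r) k * (bracket r k * cmod (c k))"
      by (simp add: mult.assoc[symmetric])
    also have "\<dots> \<le> bracket (- r) k * b"
      using le[of k] Bb[of k] by (intro mult_left_mono) auto
    finally have "cmod (c k) \<le> bracket (- r) k * b" .
    moreover have "- r \<le> 2 * real m"
      unfolding m_def using real_nat_ceiling_ge[of "\<bar>r\<bar>"] by linarith
    then have "bracket (- r) k * b \<le> bracket (2 * real m) k * b"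
      using b by (intro mult_right_mono bracket_mono)
    ultimately show ?thesis unfolding bracket_even_nat mult.commute[of b] by linarith
  qed
  then show ?thesis by (rule ex_pdistr_fourier_coeff)
qed

lemma locally_dominated_le:
  assumes f: "locally_dominated a f" and C: "0 \<le> C"
    and le: "\<And>t k. bracket r k * cmod (fourier_coeff (g t) k) \<le> C * (bracket a k * cmod (fourier_coeff (f t) k))"
  shows "locally_dominated r g"
  unfolding locally_dominated_def
proof
  fix T
  obtain B where B: "square_summable B" "\<forall>t\<in>{0..T}. \<forall>k. bracket a k * cmod (fourier_coeff (f t) k) \<le> B k"
    using f unfolding locally_dominated_def by blast
  have "bracket r k * cmod (fourier_coeff (g t) k) \<le> C * B k" if "t \<in> {0..T}" for t k
    using le[of k t] mult_left_mono[OF B(2)[rule_format, OF that, of k] C] by linarith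
  then show "\<exists>B. square_summable B \<and> (\<forall>t\<in>{0..T}. \<forall>k. bracket r k * cmod (fourier_coeff (g t) k) \<le> B k)"
    using square_summable_scale[OF B(1)] by blast
qed

lemma locally_dominated_mono:
  "locally_dominated a f \<Longrightarrow> b \<le> a \<Longrightarrow> locally_dominated b f"
  by (rule locally_dominated_le[where C = 1]) (auto intro: mult_right_mono bracket_mono)

text \<open>Applied to the embedding into the weaker space and to \<open>opA\<close>; the bound on
  differences stands in for linearity and boundedness of \<open>L\<close>.\<close>

lemma C0_curve_Lipschitz_image:
  assumes f: "C0_curve X N f" and XY: "\<And>x. x \<in> X \<Longrightarrow> L x \<in> Y"
    and Lip: "\<And>x y. x \<in> X \<Longrightarrow> y \<in> X \<Longrightarrow> N' (L x - L y) \<le> K * N (x - y)"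
    and N': "\<And>x. 0 \<le> N' x"
  shows "C0_curve Y N' (\<lambda>t. L (f t))"
  unfolding C0_curve_def converges_in_def
proof (intro allI impI conjI)
  fix t :: real assume t: "0 \<le> t"
  have ft: "f t \<in> X" and ev: "\<forall>\<^sub>F \<tau> in at t within {0..}. f \<tau> \<in> X"
    and lim: "((\<lambda>\<tau>. N (f \<tau> - f t)) \<longlongrightarrow> 0) (at t within {0..})"
    using f t by (auto simp: C0_curve_def converges_in_def)
  show "L (f t) \<in> Y" "L (f t) \<in> Y" using ft by (auto intro: XY)
  show "\<forall>\<^sub>F \<tau> in at t within {0..}. L (f \<tau>) \<in> Y"
    using ev by eventually_elim (rule XY)
  show "((\<lambda>\<tau>. N' (L (f \<tau>) - L (f t))) \<longlongrightarrow> 0) (at t within {0..})"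
  proof (rule Lim_null_comparison[OF _ tendsto_mult_right_zero[OF lim, of K]])
    show "\<forall>\<^sub>F \<tau> in at t within {0..}. norm (N' (L (f \<tau>) - L (f t))) \<le> K * N (f \<tau> - f t)"
      using ev by eventually_elim (simp add: N' Lip ft)
  qed
qed

lemma sobolev3_norm_nonneg [simp]: "0 \<le> sobolev3_norm a b c f"
  by (simp add: sobolev3_norm_eq add_nonneg_nonneg)

text \<open>Every t \<ge> 0 is a limit point of the half-line, so limits of coefficients are unique.
  The definition \<open>depends_continuously_at\<close> speaks of all derivatives of a curve, and
  this identifies them.\<close>

lemma has_time_derivative_sobolev_unique:
  assumes "has_time_derivative (sobolev r) (sobolev_norm r) f a t"
    and "has_time_derivative (sobolev r) (sobolev_norm r) f b t" and t: "0 \<le> t"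
  shows "a = b"
proof (rule pdistr_eqI)
  fix k
  have "at_right t \<le> at t within {0..}" using t by (intro at_le) auto
  then have "at t within {0..} \<noteq> bot"
    using trivial_limit_at_right_real[of t] by (metis bot.extremum_uniqueI)
  then show "fourier_coeff a k = fourier_coeff b k"
    using assms(1,2)[unfolded has_time_derivative_def, THEN converges_in_sobolev_fourier_coeff, of k]
    by (rule tendsto_unique)
qed

section \<open>The evolution of a single mode\<close>

definition osc_cos :: "real \<Rightarrow> int \<Rightarrow> real \<Rightarrow> real" where
  "osc_cos M k t = cos (of_int k * t / M)"

text \<open>The factor 1 / (k M) makes the derivative equal to
  \<open>osc_cos M k t / M\<^sup>2\<close>; the value at k = 0 is the limit as k tends to 0 and
  produces the linear drift.\<close>

definition osc_sin :: "real \<Rightarrow> int \<Rightarrow> real \<Rightarrow> real" where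
  "osc_sin M k t = (if k = 0 then t / M\<^sup>2 else sin (of_int k * t / M) / (of_int k * M))"

lemma osc_0 [simp]: "osc_cos M k 0 = 1" "osc_sin M k 0 = 0"
  by (simp_all add: osc_cos_def osc_sin_def)

text \<open>This is the determinant of the propagator of the second and third components; its value
  1 makes the inverse explicit.\<close>

lemma osc_squares:
  assumes "M > 0"
  shows "(osc_cos M k t)\<^sup>2 + M\<^sup>2 * (of_int k)\<^sup>2 * (osc_sin M k t)\<^sup>2 = 1"
  using assms by (auto simp: osc_cos_def osc_sin_def power_divide power_mult_distrib)

lemma osc_has_derivative:
  assumes "M > 0"
  shows "(osc_cos M k has_real_derivative - (of_int k)\<^sup>2 * osc_sin M k t) (at t within S)"
    and "(osc_sin M k has_real_derivative osc_cos M k t / M\<^sup>2) (at t within S)"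
proof -
  show "(osc_cos M k has_real_derivative - (of_int k)\<^sup>2 * osc_sin M k t) (at t within S)"
    unfolding osc_cos_def osc_sin_def using assms
    by (auto intro!: derivative_eq_intros simp: power2_eq_square)
  show "(osc_sin M k has_real_derivative osc_cos M k t / M\<^sup>2) (at t within S)"
    unfolding osc_cos_def osc_sin_def using assms
    by (cases "k = 0") (auto intro!: derivative_eq_intros simp: power2_eq_square)
qed

lemma abs_osc_cos_le: "\<bar>osc_cos M k t\<bar> \<le> 1"
  by (simp add: osc_cos_def)

text \<open>Meant for the small modes, above all k = 0, where a bound on |k| |osc_sin| carries no
  information.\<close>

lemma abs_osc_sin_le:
  assumes "M > 0"
  shows "\<bar>osc_sin M k t\<bar> \<le> \<bar>t\<bar> / M\<^sup>2"
proof (cases "k = 0")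
  case False
  have "\<bar>sin (of_int k * t / M)\<bar> \<le> \<bar>of_int k * t / M\<bar>" by (rule abs_sin_x_le_abs_x)
  then show ?thesis using assms False
    by (simp add: osc_sin_def abs_mult field_simps power2_eq_square)
qed (simp add: osc_sin_def)

lemma abs_osc_sin_mult_le:
  assumes "M > 0"
  shows "\<bar>of_int k\<bar> * \<bar>osc_sin M k t\<bar> \<le> 1 / M"
  using assms by (cases "k = 0") (simp_all add: osc_sin_def abs_mult field_simps)

section \<open>The propagator of a single mode and uniqueness for the scalar equations\<close>

text \<open>The symbol of \<sigma> d/dx + \<i> \<delta> d^2/dx^2 is \<i> (\<sigma> k - \<delta>
  k^2), purely imaginary, so the mode only turns its phase.\<close>

definition mode_u :: "real \<Rightarrow> real \<Rightarrow> int \<Rightarrow> real \<Rightarrow> complex \<Rightarrow> complex" where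
  "mode_u \<sigma> \<delta> k t u = cis ((\<sigma> * of_int k - \<delta> * (of_int k)\<^sup>2) * t) * u"

text \<open>A row of the propagator of v' = k^2 w, w' = - v / M^2; the other row is
  \<open>mode_w\<close>. The factor of w equals k M sin (k t / M) and thus costs one derivative of
  w.\<close>

definition mode_v :: "real \<Rightarrow> int \<Rightarrow> real \<Rightarrow> complex \<Rightarrow> complex \<Rightarrow> complex" where
  "mode_v M k t v w = osc_cos M k t *\<^sub>R v + (M\<^sup>2 * (of_int k)\<^sup>2 * osc_sin M k t) *\<^sub>R w"

definition mode_w :: "real \<Rightarrow> int \<Rightarrow> real \<Rightarrow> complex \<Rightarrow> complex \<Rightarrow> complex" where
  "mode_w M k t v w = osc_cos M k t *\<^sub>R w - osc_sin M k t *\<^sub>R v"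

lemma mode_0 [simp]: "mode_u \<sigma> \<delta> k 0 u = u" "mode_v M k 0 v w = v" "mode_w M k 0 v w = w"
  by (simp_all add: mode_u_def mode_v_def mode_w_def)

lemma mode_diff:
  "mode_u \<sigma> \<delta> k t u - mode_u \<sigma> \<delta> k t u' = mode_u \<sigma> \<delta> k t (u - u')"
  "mode_v M k t v w - mode_v M k t v' w' = mode_v M k t (v - v') (w - w')"
  "mode_w M k t v w - mode_w M k t v' w' = mode_w M k t (v - v') (w - w')"
  by (simp_all add: mode_u_def mode_v_def mode_w_def algebra_simps)

lemma cis_has_vector_derivative:
  "((\<lambda>t. cis (a * t)) has_vector_derivative \<i> * of_real a * cis (a * t)) (at t within S)"
proof -
  have "((\<lambda>t. exp (\<i> * of_real a * of_real t)) has_vector_derivative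
      \<i> * of_real a * exp (\<i> * of_real a * of_real t)) (at t within S)"
    by (auto intro!: derivative_eq_intros has_vector_derivative_real_field)
  then show ?thesis by (simp add: cis_conv_exp mult.assoc)
qed

lemma mode_has_derivative:
  shows "((\<lambda>t. mode_u \<sigma> \<delta> k t u) has_vector_derivative
      \<i> * of_real (\<sigma> * of_int k - \<delta> * (of_int k)\<^sup>2) * mode_u \<sigma> \<delta> k t u) (at t within S)"
    and "M > 0 \<Longrightarrow> ((\<lambda>t. mode_v M k t v w) has_vector_derivative
      (of_int k)\<^sup>2 * mode_w M k t v w) (at t within S)"
    and "M > 0 \<Longrightarrow> ((\<lambda>t. mode_w M k t v w) has_vector_derivative
      - ((1 / M\<^sup>2) *\<^sub>R mode_v M k t v w)) (at t within S)"
proof -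
  show "((\<lambda>t. mode_u \<sigma> \<delta> k t u) has_vector_derivative
      \<i> * of_real (\<sigma> * of_int k - \<delta> * (of_int k)\<^sup>2) * mode_u \<sigma> \<delta> k t u) (at t within S)"
    unfolding mode_u_def
    using has_vector_derivative_mult_left[OF cis_has_vector_derivative, of _ u] by (simp only: mult.assoc)
  assume M: "M > 0"
  show "((\<lambda>t. mode_v M k t v w) has_vector_derivative
      (of_int k)\<^sup>2 * mode_w M k t v w) (at t within S)"
    unfolding mode_v_def mode_w_def using M
    by (auto intro!: derivative_eq_intros osc_has_derivative simp: scaleR_conv_of_real algebra_simps)
  show "((\<lambda>t. mode_w M k t v w) has_vector_derivative
      - ((1 / M\<^sup>2) *\<^sub>R mode_v M k t v w)) (at t within S)"
    unfolding mode_v_def mode_w_def using M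
    by (auto intro!: derivative_eq_intros osc_has_derivative simp: scaleR_conv_of_real algebra_simps)
qed

lemma zero_derivative_imp_constant:
  fixes f :: "real \<Rightarrow> 'a::real_normed_vector"
  assumes "\<And>t. t \<in> {0..} \<Longrightarrow> (f has_vector_derivative 0) (at t within {0..})" "0 \<le> t"
  shows "f t = f 0"
  using has_vector_derivative_zero_constant[of "{0..}" f] assms by (metis atLeast_iff convex_real_interval(1) order_refl)

text \<open>The opposite phase is an integrating factor: its product with \<open>U\<close> has
  derivative 0 on the half-line.\<close>

lemma mode_u_unique:
  assumes U: "\<And>t. 0 \<le> t \<Longrightarrow> (U has_vector_derivative
      \<i> * of_real (\<sigma> * of_int k - \<delta> * (of_int k)\<^sup>2) * U t) (at t within {0..})" and t: "0 \<le> t"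
  shows "U t = mode_u \<sigma> \<delta> k t (U 0)"
proof -
  let ?a = "\<sigma> * of_int k - \<delta> * (of_int k)\<^sup>2"
  let ?p = "\<lambda>t. cis (- ?a * t) * U t"
  have "(?p has_vector_derivative 0) (at t within {0..})" if "t \<in> {0..}" for t
    using has_vector_derivative_mult[OF cis_has_vector_derivative[of "- ?a" t "{0..}"] U[of t]] that
    by (simp add: algebra_simps)
  from zero_derivative_imp_constant[OF this t] have "?p t = U 0" by simp
  moreover have "U t = (cis (?a * t) * cis (- ?a * t)) * U t"
    unfolding cis_mult by (simp flip: distrib_right)
  ultimately have "U t = cis (?a * t) * U 0" by (simp only: mult.assoc)
  then show ?thesis by (simp only: mode_u_def)
qed

text \<open>The inverse propagator, applied to any solution, has derivative zero.\<close>

lemma mode_vw_unique: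
  assumes M: "M > 0"
    and V: "\<And>t. 0 \<le> t \<Longrightarrow> (V has_vector_derivative (of_int k)\<^sup>2 * W t) (at t within {0..})"
    and W: "\<And>t. 0 \<le> t \<Longrightarrow> (W has_vector_derivative - ((1 / M\<^sup>2) *\<^sub>R V t)) (at t within {0..})"
    and t: "0 \<le> t"
  shows "V t = mode_v M k t (V 0) (W 0)" "W t = mode_w M k t (V 0) (W 0)"
proof -
  let ?c = "osc_cos M k" and ?s = "osc_sin M k" and ?m = "M\<^sup>2 * (of_int k)\<^sup>2"
  let ?p = "\<lambda>t. ?c t *\<^sub>R V t - (?m * ?s t) *\<^sub>R W t" and ?r = "\<lambda>t. ?c t *\<^sub>R W t + ?s t *\<^sub>R V t"
  have dp: "(?p has_vector_derivative 0) (at t within {0..})" and dr: "(?r has_vector_derivative 0) (at t within {0..})"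
    if "t \<in> {0..}" for t
    using that M
    by (auto intro!: derivative_eq_intros osc_has_derivative V W simp: scaleR_conv_of_real algebra_simps)
  have p: "?p t = V 0" and r: "?r t = W 0"
    using zero_derivative_imp_constant[OF dp t] zero_derivative_imp_constant[OF dr t] by simp_all
  \<comment> \<open>The determinant identity, inserted to undo the inverse propagator.\<close>
  have one: "V = ((?c t)\<^sup>2 + ?m * (?s t)\<^sup>2) *\<^sub>R V" for V :: complex
    using osc_squares[OF M, of k t] by simp
  show "V t = mode_v M k t (V 0) (W 0)"
    unfolding mode_v_def p[symmetric] r[symmetric]
    by (subst one[of "V t"]) (simp add: scaleR_conv_of_real power2_eq_square algebra_simps)
  show "W t = mode_w M k t (V 0) (W 0)"
    unfolding mode_w_def p[symmetric] r[symmetric]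
    by (subst one[of "W t"]) (simp add: scaleR_conv_of_real power2_eq_square algebra_simps)
qed

section \<open>Bounds on the propagator, uniform in the mode\<close>

text \<open>Collects the bounds on the entries: 1 for \<open>osc_cos\<close>, M for M^2 k^2 osc_sin
  relative to the bracket of order 1, and 1 / M + T / M^2 for that bracket times
  \<open>osc_sin\<close>.\<close>

definition growth :: "real \<Rightarrow> real \<Rightarrow> real" where
  "growth M T = 1 + M + 1 / M + T / M\<^sup>2"

lemma growth_ge_1: "M > 0 \<Longrightarrow> 0 \<le> T \<Longrightarrow> 1 \<le> growth M T"
  by (simp add: growth_def)

lemma cmod_mode_u [simp]: "cmod (mode_u \<sigma> \<delta> k t u) = cmod u"
  by (simp add: mode_u_def norm_mult)

text \<open>The off-diagonal entry grows at most like M times the bracket of k, which is exactly the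
  one derivative by which w is better than v.\<close>

lemma mode_v_le:
  assumes M: "M > 0" and t: "t \<in> {0..T}"
  shows "bracket s k * cmod (mode_v M k t v w) \<le> growth M T * (bracket s k * cmod v + bracket (s + 1) k * cmod w)"
proof -
  have G: "1 \<le> growth M T" "M \<le> growth M T" using M t by (auto simp: growth_def)
  have "\<bar>of_int k\<bar> * (\<bar>of_int k\<bar> * \<bar>osc_sin M k t\<bar>) \<le> bracket 1 k * (1 / M)"
    by (intro mult_mono abs_le_bracket_1 abs_osc_sin_mult_le M) auto
  from mult_left_mono[OF this, of "M\<^sup>2"]
  have s: "\<bar>M\<^sup>2 * (of_int k)\<^sup>2 * osc_sin M k t\<bar> \<le> M * bracket 1 k"
    using M by (simp add: abs_mult power2_eq_square mult.assoc)
  have "cmod (mode_v M k t v w) \<le> \<bar>osc_cos M k t\<bar> * cmod v + \<bar>M\<^sup>2 * (of_int k)\<^sup>2 * osc_sin M k t\<bar> * cmod w"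
    unfolding mode_v_def by (rule order_trans[OF norm_triangle_ineq]) simp
  also have "\<dots> \<le> 1 * cmod v + M * bracket 1 k * cmod w"
    by (intro add_mono mult_right_mono abs_osc_cos_le s) auto
  finally have "bracket s k * cmod (mode_v M k t v w) \<le> bracket s k * (cmod v + M * bracket 1 k * cmod w)"
    by (simp add: mult_left_mono)
  also have "\<dots> = 1 * (bracket s k * cmod v) + M * (bracket (s + 1) k * cmod w)"
    by (simp add: bracket_add algebra_simps)
  also have "\<dots> \<le> growth M T * (bracket s k * cmod v) + growth M T * (bracket (s + 1) k * cmod w)"
    by (intro add_mono mult_right_mono G) auto
  finally show ?thesis by (simp add: distrib_left)
qed

text \<open>Here \<open>osc_sin\<close> must make up for one bracket, which is at most 1 + |k|: the
  part |k| gives 1 / M, the part 1 gives T / M^2.\<close>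

lemma mode_w_le:
  assumes M: "M > 0" and t: "t \<in> {0..T}"
  shows "bracket (s + 1) k * cmod (mode_w M k t v w) \<le> growth M T * (bracket s k * cmod v + bracket (s + 1) k * cmod w)"
proof -
  have G: "1 \<le> growth M T" "1 / M + T / M\<^sup>2 \<le> growth M T" using M t by (auto simp: growth_def)
  have "bracket 1 k * \<bar>osc_sin M k t\<bar> \<le> (1 + \<bar>of_int k\<bar>) * \<bar>osc_sin M k t\<bar>"
    by (intro mult_right_mono bracket_1_le) simp
  also have "\<dots> \<le> 1 / M + T / M\<^sup>2"
    using abs_osc_sin_le[OF M, of k t] abs_osc_sin_mult_le[OF M, of k t] divide_right_mono[of t T "M\<^sup>2"] t
    by (simp add: distrib_right)
  finally have s: "bracket 1 k * \<bar>osc_sin M k t\<bar> \<le> 1 / M + T / M\<^sup>2" .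
  have "cmod (mode_w M k t v w) \<le> \<bar>osc_cos M k t\<bar> * cmod w + \<bar>osc_sin M k t\<bar> * cmod v"
    unfolding mode_w_def by (rule order_trans[OF norm_triangle_ineq4]) simp
  also have "\<dots> \<le> 1 * cmod w + \<bar>osc_sin M k t\<bar> * cmod v"
    by (intro add_mono mult_right_mono abs_osc_cos_le) auto
  finally have "bracket (s + 1) k * cmod (mode_w M k t v w) \<le> bracket (s + 1) k * (cmod w + \<bar>osc_sin M k t\<bar> * cmod v)"
    by (simp add: mult_left_mono)
  also have "\<dots> = 1 * (bracket (s + 1) k * cmod w) + (bracket 1 k * \<bar>osc_sin M k t\<bar>) * (bracket s k * cmod v)"
    by (simp add: bracket_add algebra_simps)
  also have "\<dots> \<le> growth M T * (bracket (s + 1) k * cmod w) + growth M T * (bracket s k * cmod v)"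
    using s G by (intro add_mono mult_right_mono) auto
  finally show ?thesis by (simp add: distrib_left add.commute)
qed

section \<open>The initial value problem\<close>

lemma opA_components:
  "fourier_coeff (fst (opA \<sigma> \<delta> M f)) k
    = \<i> * of_real (\<sigma> * of_int k - \<delta> * (of_int k)\<^sup>2) * fourier_coeff (fst f) k"
  "fourier_coeff (fst (snd (opA \<sigma> \<delta> M f))) k = (of_int k)\<^sup>2 * fourier_coeff (snd (snd f)) k"
  "fourier_coeff (snd (snd (opA \<sigma> \<delta> M f))) k = - ((1 / M\<^sup>2) *\<^sub>R fourier_coeff (fst (snd f)) k)"
  by (cases f; simp add: scaleR_conv_of_real power2_eq_square algebra_simps)+

lemma opA_diff: "opA \<sigma> \<delta> M (f - g) = opA \<sigma> \<delta> M f - opA \<sigma> \<delta> M g"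
proof (intro prod_eqI pdistr_eqI)
qed (simp_all add: opA_components algebra_simps)

text \<open>This is where the orders of the weaker space originate: the first component loses two
  derivatives, the second takes w from order s + 1 to s - 1, and the third keeps the order s of
  v.\<close>

lemma opA_components_le:
  assumes \<sigma>: "\<bar>\<sigma>\<bar> \<le> 1"
  shows "bracket (q - 2) k * cmod (fourier_coeff (fst (opA \<sigma> \<delta> M f)) k)
      \<le> (1 + \<bar>\<delta>\<bar>) * (bracket q k * cmod (fourier_coeff (fst f) k))" (is ?U)
    and "bracket (s - 1) k * cmod (fourier_coeff (fst (snd (opA \<sigma> \<delta> M f))) k)
      \<le> 1 * (bracket (s + 1) k * cmod (fourier_coeff (snd (snd f)) k))" (is ?V)
    and "bracket s k * cmod (fourier_coeff (snd (snd (opA \<sigma> \<delta> M f))) k)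
      \<le> 1 / M\<^sup>2 * (bracket s k * cmod (fourier_coeff (fst (snd f)) k))" (is ?W)
proof -
  have "\<bar>\<sigma> * of_int k - \<delta> * (of_int k)\<^sup>2\<bar> \<le> \<bar>\<sigma>\<bar> * \<bar>of_int k\<bar> + \<bar>\<delta>\<bar> * (of_int k)\<^sup>2"
    using abs_triangle_ineq4[of "\<sigma> * of_int k" "\<delta> * (of_int k)\<^sup>2"] by (simp add: abs_mult)
  \<comment> \<open>2 |k| \<le> 1 + k^2 absorbs the first-order term into the weight of order
    2.\<close>
  also have "\<dots> \<le> 1 * (1 + (of_int k)\<^sup>2) + \<bar>\<delta>\<bar> * (1 + (of_int k)\<^sup>2)"
    using \<sigma> sum_squares_bound[of "\<bar>of_int k\<bar>::real" 1] by (intro add_mono mult_mono) auto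
  also have "\<dots> = (1 + \<bar>\<delta>\<bar>) * bracket 2 k" by (simp add: bracket_2 algebra_simps)
  finally have \<lambda>: "\<bar>\<sigma> * of_int k - \<delta> * (of_int k)\<^sup>2\<bar> \<le> (1 + \<bar>\<delta>\<bar>) * bracket 2 k" .
  have "bracket q k = bracket (q - 2) k * bracket 2 k" by (simp add: bracket_add[symmetric])
  moreover have "bracket (q - 2) k * (\<bar>\<sigma> * of_int k - \<delta> * (of_int k)\<^sup>2\<bar> * cmod (fourier_coeff (fst f) k))
      \<le> bracket (q - 2) k * ((1 + \<bar>\<delta>\<bar>) * bracket 2 k * cmod (fourier_coeff (fst f) k))"
    by (intro mult_left_mono mult_right_mono \<lambda>) auto
  ultimately show ?U
    unfolding opA_components norm_mult norm_of_real by (simp add: mult_ac)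
  have "bracket (s + 1) k = bracket (s - 1) k * bracket 2 k" by (simp add: bracket_add[symmetric] add.commute)
  moreover have "bracket (s - 1) k * ((of_int k)\<^sup>2 * cmod (fourier_coeff (snd (snd f)) k))
      \<le> bracket (s - 1) k * (bracket 2 k * cmod (fourier_coeff (snd (snd f)) k))"
    by (intro mult_left_mono mult_right_mono) (auto simp: bracket_2)
  ultimately show ?V
    unfolding opA_components norm_mult by (simp add: norm_power mult_ac)
  show ?W by (simp add: opA_components)
qed

text \<open>The constant exceeds the three factors 2 (1 + |\<delta>|), 2 and 2 / M^2 of the
  components at once.\<close>

lemma opA_bound:
  assumes \<sigma>: "\<bar>\<sigma>\<bar> \<le> 1" and f: "f \<in> sobolev3 q s (s + 1)"
  shows "opA \<sigma> \<delta> M f \<in> sobolev3 (q - 2) (s - 1) s"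
    and "sobolev3_norm (q - 2) (s - 1) s (opA \<sigma> \<delta> M f)
      \<le> 2 * (2 + \<bar>\<delta>\<bar> + 1 / M\<^sup>2) * sobolev3_norm q s (s + 1) f"
proof -
  let ?u = "sobolev_norm q (fst f)" and ?v = "sobolev_norm s (fst (snd f))"
    and ?w = "sobolev_norm (s + 1) (snd (snd f))"
  note le = opA_components_le[OF \<sigma>, where f = f and \<delta> = \<delta> and M = M]
  have f': "fst f \<in> sobolev q" "fst (snd f) \<in> sobolev s" "snd (snd f) \<in> sobolev (s + 1)"
    using f by (simp_all add: sobolev3_iff)
  show "opA \<sigma> \<delta> M f \<in> sobolev3 (q - 2) (s - 1) s"
    unfolding sobolev3_iff using f'
    by (intro conjI sobolev_norm_le_single(1)[OF le(1)] sobolev_norm_le_single(1)[OF le(2)]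
        sobolev_norm_le_single(1)[OF le(3)]) auto
  have "sobolev_norm (q - 2) (fst (opA \<sigma> \<delta> M f)) \<le> 2 * (1 + \<bar>\<delta>\<bar>) * ?u"
    "sobolev_norm (s - 1) (fst (snd (opA \<sigma> \<delta> M f))) \<le> 2 * 1 * ?w"
    "sobolev_norm s (snd (snd (opA \<sigma> \<delta> M f))) \<le> 2 * (1 / M\<^sup>2) * ?v"
    using f' by (intro sobolev_norm_le_single(2)[OF le(1)] sobolev_norm_le_single(2)[OF le(2)]
        sobolev_norm_le_single(2)[OF le(3)]; simp)+
  moreover have "2 * (1 + \<bar>\<delta>\<bar>) * ?u \<le> 2 * (2 + \<bar>\<delta>\<bar> + 1 / M\<^sup>2) * ?u"
    "2 * 1 * ?w \<le> 2 * (2 + \<bar>\<delta>\<bar> + 1 / M\<^sup>2) * ?w"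
    "2 * (1 / M\<^sup>2) * ?v \<le> 2 * (2 + \<bar>\<delta>\<bar> + 1 / M\<^sup>2) * ?v"
    by (intro mult_right_mono; simp)+
  ultimately show "sobolev3_norm (q - 2) (s - 1) s (opA \<sigma> \<delta> M f)
      \<le> 2 * (2 + \<bar>\<delta>\<bar> + 1 / M\<^sup>2) * sobolev3_norm q s (s + 1) f"
    unfolding sobolev3_norm_eq distrib_left by linarith
qed

lemma sobolev3_embedding:
  assumes "f \<in> sobolev3 q s (s + 1)"
  shows "f \<in> sobolev3 (q - 2) (s - 1) s"
    and "sobolev3_norm (q - 2) (s - 1) s f \<le> 2 * sobolev3_norm q s (s + 1) f"
  using assms sobolev_mono[of "fst f" q "q - 2"] sobolev_mono[of "fst (snd f)" s "s - 1"]
    sobolev_mono[of "snd (snd f)" "s + 1" s]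
  by (auto simp: sobolev3_iff sobolev3_norm_eq)

section \<open>The flow and its equivalence with the initial value problem\<close>

text \<open>A predicate on curves, because distributions with given coefficients are obtained by
  existence statements; times below 0 stay arbitrary. Under the assumptions of the theorem it is
  equivalent to \<open>is_solution\<close>.\<close>

definition follows_flow ::
    "real \<Rightarrow> real \<Rightarrow> real \<Rightarrow> pdistr \<times> pdistr \<times> pdistr \<Rightarrow> (real \<Rightarrow> pdistr \<times> pdistr \<times> pdistr) \<Rightarrow> bool" where
  "follows_flow \<sigma> \<delta> M f \<Psi> \<longleftrightarrow> (\<forall>t\<ge>0. \<forall>k.
     fourier_coeff (fst (\<Psi> t)) k = mode_u \<sigma> \<delta> k t (fourier_coeff (fst f) k) \<and>
     fourier_coeff (fst (snd (\<Psi> t))) k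
       = mode_v M k t (fourier_coeff (fst (snd f)) k) (fourier_coeff (snd (snd f)) k) \<and>
     fourier_coeff (snd (snd (\<Psi> t))) k
       = mode_w M k t (fourier_coeff (fst (snd f)) k) (fourier_coeff (snd (snd f)) k))"

lemma follows_flow_unique:
  assumes "follows_flow \<sigma> \<delta> M f \<Phi>" "follows_flow \<sigma> \<delta> M f \<Psi>" "0 \<le> t"
  shows "\<Phi> t = \<Psi> t"
  using assms by (intro prod_eqI pdistr_eqI) (simp_all add: follows_flow_def)

lemma follows_flow_diff:
  assumes "follows_flow \<sigma> \<delta> M f \<Phi>" "follows_flow \<sigma> \<delta> M g \<Psi>"
  shows "follows_flow \<sigma> \<delta> M (f - g) (\<lambda>t. \<Phi> t - \<Psi> t)"
  using assms by (simp add: follows_flow_def mode_diff)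

text \<open>The propagator bounds give, at each single time, square-summable majorants and thereby
  the three distributions; the curve arises by choice over time.\<close>

lemma ex_follows_flow:
  assumes M: "M > 0" and f: "f \<in> sobolev3 q s (s + 1)"
  shows "\<exists>\<Psi>. follows_flow \<sigma> \<delta> M f \<Psi>"
proof -
  let ?u = "fourier_coeff (fst f)" and ?v = "fourier_coeff (fst (snd f))" and ?w = "fourier_coeff (snd (snd f))"
  have sq: "square_summable (\<lambda>k. bracket q k * cmod (?u k))"
    "square_summable (\<lambda>k. growth M t * (bracket s k * cmod (?v k) + bracket (s + 1) k * cmod (?w k)))" for t
    using f unfolding sobolev3_iff
    by (auto intro!: square_summable_scale square_summable_add sobolev_square_summable)
  have "\<exists>g. \<forall>k. fourier_coeff (fst g) k = mode_u \<sigma> \<delta> k t (?u k) \<and>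
      fourier_coeff (fst (snd g)) k = mode_v M k t (?v k) (?w k) \<and>
      fourier_coeff (snd (snd g)) k = mode_w M k t (?v k) (?w k)" if t: "0 \<le> t" for t
  proof -
    obtain u where "\<forall>k. fourier_coeff u k = mode_u \<sigma> \<delta> k t (?u k)"
      using ex_pdistr_sobolev[OF sq(1), of q "\<lambda>k. mode_u \<sigma> \<delta> k t (?u k)"] by auto
    moreover obtain v where "\<forall>k. fourier_coeff v k = mode_v M k t (?v k) (?w k)"
      using ex_pdistr_sobolev[OF sq(2) mode_v_le[OF M]] t by force
    moreover obtain w where "\<forall>k. fourier_coeff w k = mode_w M k t (?v k) (?w k)"
      using ex_pdistr_sobolev[OF sq(2) mode_w_le[OF M]] t by force
    ultimately show ?thesis by (intro exI[of _ "(u, v, w)"]) simp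
  qed
  then obtain \<Psi> where "\<forall>t. 0 \<le> t \<longrightarrow> (\<forall>k. fourier_coeff (fst (\<Psi> t)) k = mode_u \<sigma> \<delta> k t (?u k) \<and>
      fourier_coeff (fst (snd (\<Psi> t))) k = mode_v M k t (?v k) (?w k) \<and>
      fourier_coeff (snd (snd (\<Psi> t))) k = mode_w M k t (?v k) (?w k))"
    using choice[of "\<lambda>t g. 0 \<le> t \<longrightarrow> (\<forall>k. fourier_coeff (fst g) k = mode_u \<sigma> \<delta> k t (?u k) \<and>
      fourier_coeff (fst (snd g)) k = mode_v M k t (?v k) (?w k) \<and>
      fourier_coeff (snd (snd g)) k = mode_w M k t (?v k) (?w k))"] by blast
  then show ?thesis unfolding follows_flow_def by blast
qed

text \<open>The first component contributes the factor 2, and the other two contribute 2 *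
  \<open>growth M T\<close> each on both v and w; the total stays below the factor 6 *
  \<open>growth M T\<close>.\<close>

lemma follows_flow_bound:
  assumes M: "M > 0" and f: "f \<in> sobolev3 q s (s + 1)" and \<Psi>: "follows_flow \<sigma> \<delta> M f \<Psi>"
    and t: "t \<in> {0..T}"
  shows "\<Psi> t \<in> sobolev3 q s (s + 1)"
    and "sobolev3_norm q s (s + 1) (\<Psi> t) \<le> 6 * growth M T * sobolev3_norm q s (s + 1) f"
proof -
  let ?u = "sobolev_norm q (fst f)" and ?v = "sobolev_norm s (fst (snd f))"
    and ?w = "sobolev_norm (s + 1) (snd (snd f))"
  have G: "1 \<le> growth M T" using M t by (intro growth_ge_1) auto
  have f': "fst f \<in> sobolev q" "fst (snd f) \<in> sobolev s" "snd (snd f) \<in> sobolev (s + 1)"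
    using f by (simp_all add: sobolev3_iff)
  have u: "bracket q k * cmod (fourier_coeff (fst (\<Psi> t)) k) \<le> 1 * (bracket q k * cmod (fourier_coeff (fst f) k))"
    and v: "bracket s k * cmod (fourier_coeff (fst (snd (\<Psi> t))) k)
      \<le> growth M T * (bracket s k * cmod (fourier_coeff (fst (snd f)) k) + bracket (s + 1) k * cmod (fourier_coeff (snd (snd f)) k))"
    and w: "bracket (s + 1) k * cmod (fourier_coeff (snd (snd (\<Psi> t))) k)
      \<le> growth M T * (bracket s k * cmod (fourier_coeff (fst (snd f)) k) + bracket (s + 1) k * cmod (fourier_coeff (snd (snd f)) k))"
    for k
    using \<Psi> t mode_v_le[OF M t] mode_w_le[OF M t] by (auto simp: follows_flow_def)
  have "fst (\<Psi> t) \<in> sobolev q" "sobolev_norm q (fst (\<Psi> t)) \<le> 2 * 1 * ?u"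
    using sobolev_norm_le_single[OF u f'(1)] by auto
  moreover have "fst (snd (\<Psi> t)) \<in> sobolev s" "sobolev_norm s (fst (snd (\<Psi> t))) \<le> 2 * growth M T * (?v + ?w)"
    using sobolev_norm_le[OF v f'(2,3)] G by auto
  moreover have "snd (snd (\<Psi> t)) \<in> sobolev (s + 1)"
    "sobolev_norm (s + 1) (snd (snd (\<Psi> t))) \<le> 2 * growth M T * (?v + ?w)"
    using sobolev_norm_le[OF w f'(2,3)] G by auto
  moreover have "2 * 1 * ?u \<le> 6 * growth M T * ?u" "0 \<le> 2 * growth M T * (?v + ?w)"
    using G mult_right_mono[of "2 * 1" "6 * growth M T" ?u]
    by (simp_all add: mult_nonneg_nonneg add_nonneg_nonneg)
  ultimately show "\<Psi> t \<in> sobolev3 q s (s + 1)"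
    "sobolev3_norm q s (s + 1) (\<Psi> t) \<le> 6 * growth M T * sobolev3_norm q s (s + 1) f"
    unfolding sobolev3_iff sobolev3_norm_eq by (auto simp: distrib_left)
qed

text \<open>In coefficients the equation becomes the scalar system, whose solutions are unique; so
  every solution is prescribed mode by mode by its data.\<close>

lemma solution_follows_flow:
  assumes M: "M > 0" and sol: "is_solution \<sigma> \<delta> M q s f \<Psi>"
  shows "follows_flow \<sigma> \<delta> M f \<Psi>"
  unfolding follows_flow_def
proof (intro allI impI)
  fix t :: real and k assume t: "0 \<le> t"
  have d: "has_time_derivative (sobolev3 (q - 2) (s - 1) s) (sobolev3_norm (q - 2) (s - 1) s)
      \<Psi> (opA \<sigma> \<delta> M (\<Psi> t)) t" if "0 \<le> t" for t
    using sol that by (simp add: is_solution_def)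
  note d' = d[unfolded has_time_derivative_sobolev3]
  have U: "((\<lambda>\<tau>. fourier_coeff (fst (\<Psi> \<tau>)) k) has_vector_derivative
      \<i> * of_real (\<sigma> * of_int k - \<delta> * (of_int k)\<^sup>2) * fourier_coeff (fst (\<Psi> t)) k) (at t within {0..})"
    if "0 \<le> t" for t
    using has_time_derivative_sobolev_fourier_coeff[OF conjunct1[OF d'[OF that]], of k]
    by (simp only: opA_components)
  have V: "((\<lambda>\<tau>. fourier_coeff (fst (snd (\<Psi> \<tau>))) k) has_vector_derivative
      (of_int k)\<^sup>2 * fourier_coeff (snd (snd (\<Psi> t))) k) (at t within {0..})"
    if "0 \<le> t" for t
    using has_time_derivative_sobolev_fourier_coeff[OF conjunct1[OF conjunct2[OF d'[OF that]]], of k]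
    by (simp only: opA_components)
  have W: "((\<lambda>\<tau>. fourier_coeff (snd (snd (\<Psi> \<tau>))) k) has_vector_derivative
      - ((1 / M\<^sup>2) *\<^sub>R fourier_coeff (fst (snd (\<Psi> t))) k)) (at t within {0..})"
    if "0 \<le> t" for t
    using has_time_derivative_sobolev_fourier_coeff[OF conjunct2[OF conjunct2[OF d'[OF that]]], of k]
    by (simp only: opA_components)
  from mode_u_unique[OF U t] mode_vw_unique[OF M V W t]
  show "fourier_coeff (fst (\<Psi> t)) k = mode_u \<sigma> \<delta> k t (fourier_coeff (fst f) k) \<and>
     fourier_coeff (fst (snd (\<Psi> t))) k
       = mode_v M k t (fourier_coeff (fst (snd f)) k) (fourier_coeff (snd (snd f)) k) \<and>
     fourier_coeff (snd (snd (\<Psi> t))) k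
       = mode_w M k t (fourier_coeff (fst (snd f)) k) (fourier_coeff (snd (snd f)) k)"
    using sol by (simp add: is_solution_def)
qed

text \<open>The time derivative is found in each mode and lifted by the majorants of
  \<open>opA\<close>. Its continuity follows from that of the curve in the stronger space, since
  \<open>opA\<close> is bounded from there into the weaker one.\<close>

lemma flow_is_solution:
  assumes \<sigma>: "\<bar>\<sigma>\<bar> \<le> 1" and M: "M > 0" and f: "f \<in> sobolev3 q s (s + 1)"
    and \<Psi>: "follows_flow \<sigma> \<delta> M f \<Psi>"
  shows "is_solution \<sigma> \<delta> M q s f \<Psi>"
proof -
  let ?X = "sobolev3 q s (s + 1)" and ?N = "sobolev3_norm q s (s + 1)"
  let ?Y = "sobolev3 (q - 2) (s - 1) s" and ?N' = "sobolev3_norm (q - 2) (s - 1) s"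
  let ?A = "opA \<sigma> \<delta> M"
  have f': "fst f \<in> sobolev q" "fst (snd f) \<in> sobolev s" "snd (snd f) \<in> sobolev (s + 1)"
    using f by (simp_all add: sobolev3_iff)
  have dU: "((\<lambda>\<tau>. fourier_coeff (fst (\<Psi> \<tau>)) k) has_vector_derivative
      fourier_coeff (fst (?A (\<Psi> t))) k) (at t within {0..})" if "0 \<le> t" for t k
    using has_vector_derivative_transform[OF _ _ mode_has_derivative(1), of t "{0..}"
        "\<lambda>\<tau>. fourier_coeff (fst (\<Psi> \<tau>)) k" \<sigma> \<delta> k "fourier_coeff (fst f) k"] that \<Psi>
    by (simp add: opA_components follows_flow_def)
  have dV: "((\<lambda>\<tau>. fourier_coeff (fst (snd (\<Psi> \<tau>))) k) has_vector_derivative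
      fourier_coeff (fst (snd (?A (\<Psi> t)))) k) (at t within {0..})" if "0 \<le> t" for t k
    using has_vector_derivative_transform[OF _ _ mode_has_derivative(2)[OF M], of t "{0..}"
        "\<lambda>\<tau>. fourier_coeff (fst (snd (\<Psi> \<tau>))) k" k
        "fourier_coeff (fst (snd f)) k" "fourier_coeff (snd (snd f)) k"] that \<Psi>
    by (simp add: opA_components follows_flow_def)
  have dW: "((\<lambda>\<tau>. fourier_coeff (snd (snd (\<Psi> \<tau>))) k) has_vector_derivative
      fourier_coeff (snd (snd (?A (\<Psi> t)))) k) (at t within {0..})" if "0 \<le> t" for t k
    using has_vector_derivative_transform[OF _ _ mode_has_derivative(3)[OF M], of t "{0..}"
        "\<lambda>\<tau>. fourier_coeff (snd (snd (\<Psi> \<tau>))) k" k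
        "fourier_coeff (fst (snd f)) k" "fourier_coeff (snd (snd f)) k"] that \<Psi>
    by (simp add: opA_components follows_flow_def)
  have U: "locally_dominated q (\<lambda>t. fst (\<Psi> t))"
    unfolding locally_dominated_def
  proof
    fix T
    show "\<exists>B. square_summable B \<and> (\<forall>t\<in>{0..T}. \<forall>k. bracket q k * cmod (fourier_coeff (fst (\<Psi> t)) k) \<le> B k)"
      using \<Psi> f'(1) by (intro exI[of _ "\<lambda>k. bracket q k * cmod (fourier_coeff (fst f) k)"])
        (auto simp: follows_flow_def sobolev_square_summable)
  qed
  \<comment> \<open>\<open>mode_v_le\<close> and \<open>mode_w_le\<close> share their right-hand
    side, so one majorant built from the data serves both components.\<close>
  let ?B = "\<lambda>T k. growth M T * (bracket s k * cmod (fourier_coeff (fst (snd f)) k) + bracket (s + 1) k * cmod (fourier_coeff (snd (snd f)) k))"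
  have B: "square_summable (?B T)" for T
    using f' by (intro square_summable_scale square_summable_add sobolev_square_summable)
  have V: "locally_dominated s (\<lambda>t. fst (snd (\<Psi> t)))"
    unfolding locally_dominated_def
    using B \<Psi> by (intro allI exI[of _ "?B _"]) (auto simp: follows_flow_def intro!: mode_v_le[OF M])
  have W: "locally_dominated (s + 1) (\<lambda>t. snd (snd (\<Psi> t)))"
    unfolding locally_dominated_def
    using B \<Psi> by (intro allI exI[of _ "?B _"]) (auto simp: follows_flow_def intro!: mode_w_le[OF M])
  have tendsto: "(g \<longlongrightarrow> g t) (at t within {0..})" if "(g has_vector_derivative d) (at t within {0..})"
    for g :: "real \<Rightarrow> complex" and d t
    using has_vector_derivative_continuous[OF that] by (simp add: continuous_within)
  have C0: "C0_curve ?X ?N \<Psi>"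
    unfolding C0_curve_sobolev3
    by (intro conjI C0_curve_sobolevI U V W tendsto[OF dU] tendsto[OF dV] tendsto[OF dW])
  have C0': "C0_curve ?Y ?N' \<Psi>"
  proof (rule C0_curve_Lipschitz_image[OF C0, where L = "\<lambda>x. x" and K = 2])
    show "?N' (x - y) \<le> 2 * ?N (x - y)" if "x \<in> ?X" "y \<in> ?X" for x y
      using that by (intro sobolev3_embedding) (simp add: sobolev3_iff sobolev_diff)
  qed (simp_all add: sobolev3_embedding)
  have C0A: "C0_curve ?Y ?N' (\<lambda>t. ?A (\<Psi> t))"
  proof (rule C0_curve_Lipschitz_image[OF C0])
    show "?N' (?A x - ?A y) \<le> 2 * (2 + \<bar>\<delta>\<bar> + 1 / M\<^sup>2) * ?N (x - y)" if "x \<in> ?X" "y \<in> ?X" for x y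
      unfolding opA_diff[symmetric]
      using that by (intro opA_bound \<sigma>) (simp add: sobolev3_iff sobolev_diff)
  qed (simp_all add: opA_bound \<sigma>)
  have deriv: "has_time_derivative ?Y ?N' \<Psi> (?A (\<Psi> t)) t" if t: "0 \<le> t" for t
    unfolding has_time_derivative_sobolev3
  proof (intro conjI)
    show "has_time_derivative (sobolev (q - 2)) (sobolev_norm (q - 2)) (\<lambda>t. fst (\<Psi> t)) (fst (?A (\<Psi> t))) t"
      by (rule has_time_derivative_sobolevI[where d = "\<lambda>t. fst (?A (\<Psi> t))", OF _ _ t dU])
        (auto intro: locally_dominated_mono[OF U] locally_dominated_le[OF U _ opA_components_le(1)[OF \<sigma>]])
    \<comment> \<open>\<open>A\<close> is off-diagonal in these two components: the derivative of
      the second is dominated through the third, and conversely.\<close>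
    show "has_time_derivative (sobolev (s - 1)) (sobolev_norm (s - 1)) (\<lambda>t. fst (snd (\<Psi> t))) (fst (snd (?A (\<Psi> t)))) t"
      by (rule has_time_derivative_sobolevI[where d = "\<lambda>t. fst (snd (?A (\<Psi> t)))", OF _ _ t dV])
        (auto intro: locally_dominated_mono[OF V] locally_dominated_le[OF W _ opA_components_le(2)[OF \<sigma>]])
    show "has_time_derivative (sobolev s) (sobolev_norm s) (\<lambda>t. snd (snd (\<Psi> t))) (snd (snd (?A (\<Psi> t)))) t"
      by (rule has_time_derivative_sobolevI[where d = "\<lambda>t. snd (snd (?A (\<Psi> t)))", OF _ _ t dW])
        (auto intro: locally_dominated_mono[OF W] locally_dominated_le[OF V _ opA_components_le(3)[OF \<sigma>]])
  qed
  have "\<Psi> 0 = f"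
    using \<Psi> by (intro prod_eqI pdistr_eqI) (simp_all add: follows_flow_def)
  with C0 C0' C0A deriv show ?thesis
    unfolding is_solution_def C1_curve_def by (intro conjI exI[of _ "\<lambda>t. ?A (\<Psi> t)"] allI impI) simp_all
qed

text \<open>The difference of two solutions follows the flow of the difference of the data, so one
  bound on the flow serves all data and e / C does not depend on \<open>g\<close>.\<close>

lemma solutions_depend_continuously:
  assumes \<sigma>: "\<bar>\<sigma>\<bar> \<le> 1" and M: "M > 0"
  shows "depends_continuously_at \<sigma> \<delta> M q s g"
  unfolding depends_continuously_at_def Let_def
proof (intro allI impI)
  let ?X = "sobolev3 q s (s + 1)" and ?N = "sobolev3_norm q s (s + 1)"
  let ?Y = "sobolev3 (q - 2) (s - 1) s" and ?N' = "sobolev3_norm (q - 2) (s - 1) s"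
  fix \<Psi> and T e :: real
  assume \<Psi>: "is_solution \<sigma> \<delta> M q s g \<Psi>" and T: "0 < T" and e: "0 < e"
  \<comment> \<open>The datum lies in the space because the curve does at t = 0.\<close>
  have g: "g \<in> ?X" using \<Psi> by (auto simp: is_solution_def C0_curve_def)
  \<comment> \<open>One constant for both passages to the weaker space: the embedding, with factor
    2, and \<open>opA\<close>.\<close>
  define K where "K = 2 * (2 + \<bar>\<delta>\<bar> + 1 / M\<^sup>2)"
  have K: "2 \<le> K" by (simp add: K_def)
  define C where "C = K * (6 * growth M T)"
  have C: "0 < C" using K growth_ge_1[OF M, of T] T by (simp add: C_def)
  have main: "?N (\<Phi> t - \<Psi> t) < e \<and> ?N' (\<Phi> t - \<Psi> t) < e \<and>
      (\<forall>a b. has_time_derivative ?Y ?N' \<Phi> a t \<longrightarrow> has_time_derivative ?Y ?N' \<Psi> b t \<longrightarrow> ?N' (a - b) < e)"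
    if f: "f \<in> ?X" and \<Phi>: "is_solution \<sigma> \<delta> M q s f \<Phi>" and fg: "?N (f - g) < e / C" and t: "t \<in> {0..T}"
    for f \<Phi> t
  proof -
    let ?D = "\<Phi> t - \<Psi> t"
    have "f - g \<in> ?X" using f g by (simp add: sobolev3_iff sobolev_diff)
    moreover have "follows_flow \<sigma> \<delta> M (f - g) (\<lambda>t. \<Phi> t - \<Psi> t)"
      by (intro follows_flow_diff solution_follows_flow[OF M \<Phi>] solution_follows_flow[OF M \<Psi>])
    ultimately have D: "?D \<in> ?X" "?N ?D \<le> 6 * growth M T * ?N (f - g)"
      using follows_flow_bound[OF M _ _ t] by blast+
    have "K * ?N ?D \<le> C * ?N (f - g)"
      using mult_left_mono[OF D(2), of K] K by (simp add: C_def)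
    also have "\<dots> < e" using fg C by (simp add: pos_less_divide_eq mult.commute)
    finally have KD: "K * ?N ?D < e" .
    have "1 * ?N ?D \<le> K * ?N ?D" "2 * ?N ?D \<le> K * ?N ?D" using K by (intro mult_right_mono; simp)+
    moreover have "?N' ?D \<le> 2 * ?N ?D" using D(1) by (rule sobolev3_embedding)
    ultimately have 1: "?N ?D < e" "?N' ?D < e" using KD by linarith+
    have "?N' (a - b) < e" if a: "has_time_derivative ?Y ?N' \<Phi> a t" and b: "has_time_derivative ?Y ?N' \<Psi> b t" for a b
    proof -
      have "has_time_derivative ?Y ?N' \<Phi> (opA \<sigma> \<delta> M (\<Phi> t)) t" "has_time_derivative ?Y ?N' \<Psi> (opA \<sigma> \<delta> M (\<Psi> t)) t"
        using \<Phi> \<Psi> t by (auto simp: is_solution_def)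
      \<comment> \<open>\<open>a\<close> and \<open>b\<close> are arbitrary derivatives; uniqueness
        identifies them with the right-hand sides of the two equations, whose difference
        \<open>opA_bound\<close> controls.\<close>
      then have "a = opA \<sigma> \<delta> M (\<Phi> t)" "b = opA \<sigma> \<delta> M (\<Psi> t)"
        using a b t unfolding has_time_derivative_sobolev3
        by (auto intro!: prod_eqI intro: has_time_derivative_sobolev_unique)
      then have "?N' (a - b) \<le> K * ?N ?D"
        using opA_bound(2)[OF \<sigma> D(1)] by (simp add: K_def opA_diff)
      with KD show ?thesis by simp
    qed
    with 1 show ?thesis by blast
  qed
  show "\<exists>\<eta>>0. \<forall>\<Phi>\<^sub>0\<in>?X. \<forall>\<Phi>. is_solution \<sigma> \<delta> M q s \<Phi>\<^sub>0 \<Phi> \<longrightarrow> ?N (\<Phi>\<^sub>0 - g) < \<eta> \<longrightarrow>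
      (\<forall>t\<in>{0..T}. ?N (\<Phi> t - \<Psi> t) < e \<and> ?N' (\<Phi> t - \<Psi> t) < e \<and>
        (\<forall>a b. has_time_derivative ?Y ?N' \<Phi> a t \<longrightarrow> has_time_derivative ?Y ?N' \<Psi> b t \<longrightarrow> ?N' (a - b) < e))"
    using main e C by (intro exI[of _ "e / C"]) auto
qed

theorem theorem1p1:
  fixes \<sigma>\<^sub>3 \<delta> M q s :: real
  assumes "\<sigma>\<^sub>3 \<in> {1, -1}" and "M > 0"
  shows "\<forall>\<Psi>\<^sub>0 \<in> sobolev3 q s (s + 1).
           (\<exists>\<Psi>. is_solution \<sigma>\<^sub>3 \<delta> M q s \<Psi>\<^sub>0 \<Psi> \<and>
                (\<forall>\<Phi>. is_solution \<sigma>\<^sub>3 \<delta> M q s \<Psi>\<^sub>0 \<Phi> \<longrightarrow> (\<forall>t\<ge>0. \<Phi> t = \<Psi> t))) \<and>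
           depends_continuously_at \<sigma>\<^sub>3 \<delta> M q s \<Psi>\<^sub>0"
proof (intro ballI conjI)
  have \<sigma>: "\<bar>\<sigma>\<^sub>3\<bar> \<le> 1" using assms(1) by auto
  fix \<Psi>\<^sub>0 assume \<Psi>\<^sub>0: "\<Psi>\<^sub>0 \<in> sobolev3 q s (s + 1)"
  obtain \<Psi> where \<Psi>: "follows_flow \<sigma>\<^sub>3 \<delta> M \<Psi>\<^sub>0 \<Psi>" using ex_follows_flow[OF assms(2) \<Psi>\<^sub>0] by blast
  show "\<exists>\<Psi>. is_solution \<sigma>\<^sub>3 \<delta> M q s \<Psi>\<^sub>0 \<Psi> \<and>
      (\<forall>\<Phi>. is_solution \<sigma>\<^sub>3 \<delta> M q s \<Psi>\<^sub>0 \<Phi> \<longrightarrow> (\<forall>t\<ge>0. \<Phi> t = \<Psi> t))"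
    using flow_is_solution[OF \<sigma> assms(2) \<Psi>\<^sub>0 \<Psi>] follows_flow_unique[OF solution_follows_flow[OF assms(2)] \<Psi>]
    by blast
  show "depends_continuously_at \<sigma>\<^sub>3 \<delta> M q s \<Psi>\<^sub>0"
    using \<sigma> assms(2) by (rule solutions_depend_continuously)
qed

end
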